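(* Let $C$ be a generic hedgehog (a $k$-hedgehog with $k$ a positive half-integer) and let $\mathbb E(C)$ be its extended evolutoids front, with the associated parameterization $F:M\to\mathbb R^3$. Then $$\int_M K\,dA=-2\int_\Sigma\kappa_s\,d\tau ,$$ where $K$ is the Gaussian curvature of $F$, $dA$ its unsigned area form, $\Sigma\subset M$ the set of singular points of $F$, $\kappa_s$ the singular curvature, and $d\tau$ the arc length measure of the image of the singular curve under $F$.
   Context: Hedgehogs. A hedgehog $C$ with smooth support function $p:\mathbb R\to\mathbb R$ is the curve $f_C(\theta)=\big(p(\theta)\cos\theta-p'(\theta)\sin\theta,\ p(\theta)\sin\theta+p'(\theta)\cos\theta\big)$. It is a $k$-hedgehog ($2k$ a positive integer) if it closes up after $\theta$ increases by $2k\pi$, i.e. $p(\theta+2k\pi)=(-1)^{2k}p(\theta)$. Set $t(\theta)=(-\sin\theta,\cos\theta)$, $n(\theta)=(-\cos\theta,-\sin\theta)$, $\rho=p+p''$ (signed radius of curvature). A singular point of a smooth parameterized planar curve $g$ (a point with $g'(s_0)=0$) is a cusp if $g''(s_0),g'''(s_0)$ are linearly independent. A regular point is an inflexion point if the signed curvature changes sign there, an undulation point if the curvature vanishes but does not change sign; an inflexion point is non-degenerate if $\det(g'(s_0),g'''(s_0))\ne0$. The singular evolutoids set of $C$ (all singular points of all $\alpha$-evolutoids, $\alpha\in[0,\pi]$) is parameterized by $\gamma_{SES(C)}(\theta)=f_C(\theta)+\dfrac{-\rho^2\rho'\,t+\rho^3\,n}{\rho^2+\rho'^2}(\theta)$.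 $C$ is generic if $C$ has at most cusp singularities and $\gamma_{SES(C)}$ has at most cusp singularities, no undulation points and only non-degenerate inflexion points. Extended front. $M=[0,\pi]\times S^1$ with coordinates $(\alpha,\theta)$ and orientation given by $(\alpha,\theta)$, where $S^1=\mathbb R/2\tilde k\pi\mathbb Z$, $\tilde k=k$ if $k$ is an integer and $\tilde k=2k$ otherwise (double covering of $C$). The $\alpha$-evolutoid of $C$ (envelope of tangent lines rotated by $\alpha$ about their tangency points) is parameterized by $f_\alpha(\theta)=f_C(\theta)+\rho(\theta)\sin\alpha\; t(\theta+\alpha)$. The extended evolutoids front $\mathbb E(C)=\bigcup_{\alpha\in[0,\pi]}\{\alpha\}\times\mathcal E_\alpha(C)\subset\mathbb R\times\mathbb R^2$, where $\mathcal E_\alpha(C)$ is the $\alpha$-evolutoid, is parameterized by $F(\alpha,\theta)=(\alpha,f_\alpha(\theta))$, with unit normal $\nu(\alpha,\theta)=\big(-\rho(\theta)\sin\alpha,\ n(\theta+\alpha)\big)/\sqrt{1+\rho^2(\theta)\sin^2\alpha}$. Curvature and area. The signed area density is $\lambda=\det(F_\alpha,F_\theta,\nu)=\big(\rho(\theta)\cos\alpha+\rho'(\theta)\sin\alpha\big)\sqrt{1+\rho^2(\theta)\sin^2\alpha}$; $\Sigma=\{\lambda=0\}$; $dA=|\lambda|\,d\alpha\wedge d\theta$; $K$ is the Gaussian curvature of the first fundamental form of $F$ on $M\setminus\Sigma$. At a singular point the null direction is the kernel of $dF$. A singular point with $d\lambda\ne0$, near which $\Sigma$ is a regular curve, is an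 $A_2$-point if the null direction is transversal to $\Sigma$ there. Let $\sigma$ be a parameterization of a singular curve consisting of $A_2$-points, $\hat\sigma=F\circ\sigma$, and let $\eta$ be a null vector field along $\sigma$ with $(\sigma',\eta)$ positively oriented. The singular curvature is $\kappa_s=\mathrm{sgn}\big(d\lambda(\eta)\big)\,\dfrac{\det(\hat\sigma',\hat\sigma'',\nu)}{|\hat\sigma'|^3}$. It is defined at $A_2$-points, i.e. on $\Sigma$ away from finitely many points, and the integral over $\Sigma$ is taken over the $A_2$-points. *)

theory Defs
  imports "HOL-Analysis.Analysis"
begin

section \<open>Smooth functions and curves\<close>

abbreviation D :: "(real \<Rightarrow> 'a::real_normed_vector) \<Rightarrow> real \<Rightarrow> 'a" where
  "D f \<equiv> \<lambda>s. vector_derivative f (at s)"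

definition smooth_on :: "real set \<Rightarrow> (real \<Rightarrow> 'a::real_normed_vector) \<Rightarrow> bool" where
  "smooth_on U f \<longleftrightarrow> (\<forall>n. \<forall>s\<in>U. (D ^^ n) f differentiable (at s))"

definition det2 :: "real^2 \<Rightarrow> real^2 \<Rightarrow> real" where
  "det2 u v = det (vector [u, v] :: real^2^2)"

definition det3 :: "real^3 \<Rightarrow> real^3 \<Rightarrow> real^3 \<Rightarrow> real" where
  "det3 u v w = det (vector [u, v, w] :: real^3^3)"

text \<open>The condition \<open>a \<noteq> b\<close> is needed since \<open>independent\<close> is a property of the set.\<close>

definition cusp_at :: "(real \<Rightarrow> real^2) \<Rightarrow> real \<Rightarrow> bool" where
  "cusp_at g s \<longleftrightarrow> D g s = 0 \<and>
     (let a = D (D g) s; b = D (D (D g)) s in a \<noteq> b \<and> independent {a, b})"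

definition signed_curvature :: "(real \<Rightarrow> real^2) \<Rightarrow> real \<Rightarrow> real" where
  "signed_curvature g s = det2 (D g s) (D (D g) s) / norm (D g s) ^ 3"

definition changes_sign_at :: "(real \<Rightarrow> real) \<Rightarrow> real \<Rightarrow> bool" where
  "changes_sign_at h s \<longleftrightarrow>
     (\<exists>e>0. \<forall>x\<in>{s - e<..<s}. \<forall>y\<in>{s<..<s + e}. h x * h y < 0)"

definition inflexion_at :: "(real \<Rightarrow> real^2) \<Rightarrow> real \<Rightarrow> bool" where
  "inflexion_at g s \<longleftrightarrow> D g s \<noteq> 0 \<and> changes_sign_at (signed_curvature g) s"

definition undulation_at :: "(real \<Rightarrow> real^2) \<Rightarrow> real \<Rightarrow> bool" where
  "undulation_at g s \<longleftrightarrow> D g s \<noteq> 0 \<and> signed_curvature g s = 0 \<and>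
     \<not> changes_sign_at (signed_curvature g) s"

definition nondegenerate_inflexion_at :: "(real \<Rightarrow> real^2) \<Rightarrow> real \<Rightarrow> bool" where
  "nondegenerate_inflexion_at g s \<longleftrightarrow> inflexion_at g s \<and> det2 (D g s) (D (D (D g)) s) \<noteq> 0"

definition at_most_cusps :: "(real \<Rightarrow> real^2) \<Rightarrow> bool" where
  "at_most_cusps g \<longleftrightarrow> (\<forall>s. D g s = 0 \<longrightarrow> cusp_at g s)"

section \<open>Hedgehogs\<close>

text \<open>A hedgehog is represented by its support function \<open>p\<close>.\<close>

definition tvec :: "real \<Rightarrow> real^2" where
  "tvec \<theta> = vector [- sin \<theta>, cos \<theta>]"

definition nvec :: "real \<Rightarrow> real^2" where
  "nvec \<theta> = vector [- cos \<theta>, - sin \<theta>]"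

definition hedgehog_curve :: "(real \<Rightarrow> real) \<Rightarrow> real \<Rightarrow> real^2" where
  "hedgehog_curve p \<theta> = vector [p \<theta> * cos \<theta> - D p \<theta> * sin \<theta>, p \<theta> * sin \<theta> + D p \<theta> * cos \<theta>]"

definition k_hedgehog :: "real \<Rightarrow> (real \<Rightarrow> real) \<Rightarrow> bool" where
  "k_hedgehog k p \<longleftrightarrow> smooth_on UNIV p \<and>
     (\<exists>m::nat. m > 0 \<and> 2 * k = real m \<and> (\<forall>\<theta>. p (\<theta> + 2 * k * pi) = (-1) ^ m * p \<theta>))"

definition curvature_radius :: "(real \<Rightarrow> real) \<Rightarrow> real \<Rightarrow> real" where
  "curvature_radius p \<theta> = p \<theta> + D (D p) \<theta>"

definition ses_curve :: "(real \<Rightarrow> real) \<Rightarrow> real \<Rightarrow> real^2" where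
  "ses_curve p \<theta> = (let \<rho> = curvature_radius p \<theta>; \<rho>' = D (curvature_radius p) \<theta> in
     hedgehog_curve p \<theta> +
     (1 / (\<rho>^2 + \<rho>'^2)) *\<^sub>R ((- (\<rho>^2 * \<rho>')) *\<^sub>R tvec \<theta> + \<rho>^3 *\<^sub>R nvec \<theta>))"

definition generic_hedgehog :: "(real \<Rightarrow> real) \<Rightarrow> bool" where
  "generic_hedgehog p \<longleftrightarrow> at_most_cusps (hedgehog_curve p) \<and> at_most_cusps (ses_curve p) \<and>
     (\<forall>\<theta>. \<not> undulation_at (ses_curve p) \<theta>) \<and>
     (\<forall>\<theta>. inflexion_at (ses_curve p) \<theta> \<longrightarrow> nondegenerate_inflexion_at (ses_curve p) \<theta>)"

section \<open>Gaussian curvature of a metric\<close>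

text \<open>
  A metric on a coordinate domain assigns to each point a bilinear form on tangent vectors.
  For constant vector fields \<open>X\<close> and \<open>Y\<close>, the Levi-Civita derivative of \<open>Y\<close> along \<open>X\<close> is given
  by the Koszul formula; its components are the Christoffel symbols. As constant fields commute,
  the curvature tensor has no bracket term.
\<close>

definition levi_civita ::
  "('a::euclidean_space \<Rightarrow> 'a \<Rightarrow> 'a \<Rightarrow> real) \<Rightarrow> 'a \<Rightarrow> 'a \<Rightarrow> 'a \<Rightarrow> 'a" where
  "levi_civita g x X Y = (THE V. \<forall>Z. 2 * g x V Z =
     frechet_derivative (\<lambda>y. g y Y Z) (at x) X +
     frechet_derivative (\<lambda>y. g y X Z) (at x) Y -
     frechet_derivative (\<lambda>y. g y X Y) (at x) Z)"

definition riemann_curvature ::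
  "('a::euclidean_space \<Rightarrow> 'a \<Rightarrow> 'a \<Rightarrow> real) \<Rightarrow> 'a \<Rightarrow> 'a \<Rightarrow> 'a \<Rightarrow> 'a \<Rightarrow> 'a" where
  "riemann_curvature g x X Y Z =
     frechet_derivative (\<lambda>y. levi_civita g y Y Z) (at x) X -
     frechet_derivative (\<lambda>y. levi_civita g y X Z) (at x) Y +
     levi_civita g x X (levi_civita g x Y Z) - levi_civita g x Y (levi_civita g x X Z)"

definition gaussian_curvature ::
  "(real \<times> real \<Rightarrow> real \<times> real \<Rightarrow> real \<times> real \<Rightarrow> real) \<Rightarrow> real \<times> real \<Rightarrow> real" where
  "gaussian_curvature g x = (let X = (1, 0); Y = (0, 1) in
     g x (riemann_curvature g x X Y Y) X / (g x X X * g x Y Y - (g x X Y)^2))"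

definition first_fundamental_form ::
  "('a::real_normed_vector \<Rightarrow> 'b::real_inner) \<Rightarrow> 'a \<Rightarrow> 'a \<Rightarrow> 'a \<Rightarrow> real" where
  "first_fundamental_form f x v w = frechet_derivative f (at x) v \<bullet> frechet_derivative f (at x) w"

section \<open>The extended evolutoids front\<close>

text \<open>
  Points of \<open>M\<close> are written \<open>(\<alpha>, \<theta>)\<close>. The maps below are defined for all real \<open>\<alpha>\<close> and \<open>\<theta>\<close>, so that
  derivatives make sense on the boundary of \<open>M\<close>; the circle factor is represented by the
  fundamental domain \<open>{0..<2 * k_tilde k * pi}\<close>.
\<close>

definition k_tilde :: "real \<Rightarrow> real" where
  "k_tilde k = (if k \<in> \<int> then k else 2 * k)"

definition front_domain :: "real \<Rightarrow> (real \<times> real) set" where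
  "front_domain k = {0..pi} \<times> {0..<2 * k_tilde k * pi}"

definition evolutoid :: "(real \<Rightarrow> real) \<Rightarrow> real \<Rightarrow> real \<Rightarrow> real^2" where
  "evolutoid p \<alpha> \<theta> = hedgehog_curve p \<theta> + (curvature_radius p \<theta> * sin \<alpha>) *\<^sub>R tvec (\<theta> + \<alpha>)"

definition front :: "(real \<Rightarrow> real) \<Rightarrow> real \<times> real \<Rightarrow> real^3" where
  "front p = (\<lambda>(\<alpha>, \<theta>). vector [\<alpha>, evolutoid p \<alpha> \<theta> $ 1, evolutoid p \<alpha> \<theta> $ 2])"

definition front_normal :: "(real \<Rightarrow> real) \<Rightarrow> real \<times> real \<Rightarrow> real^3" where
  "front_normal p = (\<lambda>(\<alpha>, \<theta>). let \<rho> = curvature_radius p \<theta> in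
     (1 / sqrt (1 + \<rho>^2 * (sin \<alpha>)^2)) *\<^sub>R
       vector [- (\<rho> * sin \<alpha>), nvec (\<theta> + \<alpha>) $ 1, nvec (\<theta> + \<alpha>) $ 2])"

definition area_density :: "(real \<Rightarrow> real) \<Rightarrow> real \<times> real \<Rightarrow> real" where
  "area_density p x = det3 (frechet_derivative (front p) (at x) (1, 0))
     (frechet_derivative (front p) (at x) (0, 1)) (front_normal p x)"

definition front_curvature :: "(real \<Rightarrow> real) \<Rightarrow> real \<times> real \<Rightarrow> real" where
  "front_curvature p = gaussian_curvature (first_fundamental_form (front p))"

definition singular_set :: "real \<Rightarrow> (real \<Rightarrow> real) \<Rightarrow> (real \<times> real) set" where
  "singular_set k p = {x \<in> front_domain k. area_density p x = 0}"

text \<open>Where the differential of \<open>area_density p\<close> does not vanish, its kernel is the tangent line of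
  the singular curve.\<close>

definition A2_points :: "real \<Rightarrow> (real \<Rightarrow> real) \<Rightarrow> (real \<times> real) set" where
  "A2_points k p = {x \<in> singular_set k p.
     (\<exists>v. frechet_derivative (area_density p) (at x) v \<noteq> 0) \<and>
     (\<forall>v. frechet_derivative (front p) (at x) v = 0 \<and> v \<noteq> 0 \<longrightarrow>
          frechet_derivative (area_density p) (at x) v \<noteq> 0)}"

section \<open>Singular curvature\<close>

text \<open>A null vector \<open>v\<close> at \<open>\<sigma> s\<close> for which \<open>(\<sigma>' s, v)\<close> is positively oriented. At an \<open>A2\<close>-point it
  is unique up to a positive factor, which does not affect the sign used below.\<close>

definition oriented_null_vector ::
  "(real \<Rightarrow> real) \<Rightarrow> (real \<Rightarrow> real \<times> real) \<Rightarrow> real \<Rightarrow> real \<times> real" where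
  "oriented_null_vector p \<sigma> s = (SOME v. frechet_derivative (front p) (at (\<sigma> s)) v = 0 \<and>
     fst (D \<sigma> s) * snd v - snd (D \<sigma> s) * fst v > 0)"

definition singular_curvature ::
  "(real \<Rightarrow> real) \<Rightarrow> (real \<Rightarrow> real \<times> real) \<Rightarrow> real \<Rightarrow> real" where
  "singular_curvature p \<sigma> s =
     sgn (frechet_derivative (area_density p) (at (\<sigma> s)) (oriented_null_vector p \<sigma> s)) *
     (det3 (D (front p \<circ> \<sigma>) s) (D (D (front p \<circ> \<sigma>)) s) (front_normal p (\<sigma> s)) /
      norm (D (front p \<circ> \<sigma>) s) ^ 3)"

text \<open>
  The \<open>A2\<close>-points form finitely many arcs and possibly closed curves. Their parameter intervals
  may be taken disjoint, so a single map \<open>\<sigma>\<close> on an open set \<open>U\<close> of reals parameterizes all of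
  them. Finitely many points may be left out: end points of arcs lie on the boundary of \<open>M\<close> or of
  the fundamental domain, and a closed curve has to be cut once. They do not affect integrals with
  respect to arc length.
\<close>

definition A2_parameterization ::
  "real \<Rightarrow> (real \<Rightarrow> real) \<Rightarrow> real set \<Rightarrow> (real \<Rightarrow> real \<times> real) \<Rightarrow> bool" where
  "A2_parameterization k p U \<sigma> \<longleftrightarrow> open U \<and> smooth_on U \<sigma> \<and> (\<forall>s\<in>U. D \<sigma> s \<noteq> 0) \<and> inj_on \<sigma> U \<and>
     \<sigma> ` U \<subseteq> A2_points k p \<and> finite (A2_points k p - \<sigma> ` U)"

end

theory Submission
  imports Defs
begin

text \<open>
  With \<open>\<rho>\<close> the radius of curvature and \<open>\<mu> = \<rho> cos \<alpha> + \<rho>' sin \<alpha>\<close>, the signed curvature form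
  \<open>K \<lambda> d\<alpha> d\<theta>\<close> equals \<open>dh \<and> d(\<alpha> + \<theta>)\<close> with \<open>h = m / sqrt (1 + m\<^sup>2)\<close>, \<open>m = \<rho> sin \<alpha>\<close>, and the
  unsigned one is \<open>sgn \<mu>\<close> times it. For fixed \<open>\<theta>\<close> the function \<open>\<mu>\<close> is \<open>R sin (a - \<alpha>)\<close> with one zero
  \<open>a\<close> in \<open>[0, \<pi>]\<close>, so \<open>\<Sigma>\<close> is essentially a graph over the \<open>\<theta>\<close>-circle, and the integral over
  \<open>\<alpha>\<close> is an explicit function \<open>2 J(\<theta>)\<close>. Likewise the singular curvature measure is \<open>\<Phi>(\<theta>) |d\<theta>|\<close> for
  every parameterization. Finally \<open>J + \<Phi>\<close> is twice the derivative of the periodic function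
  \<open>- arctan (\<rho> \<rho>' / sqrt (\<rho>\<^sup>2 + \<rho>'\<^sup>2 + \<rho>\<^sup>4))\<close>, so \<open>\<integral> 2 J = - 2 \<integral> \<Phi>\<close>. Genericity gives
  \<open>(\<rho>, \<rho>') \<noteq> 0\<close> and makes the zeros of \<open>q = \<rho>'\<^sup>2 - \<rho> \<rho>''\<close>, over which the singular points are not
  \<open>A2\<close>, isolated.
\<close>

section \<open>First fundamental form and area density\<close>

locale smooth_hedgehog =
  fixes p :: "real \<Rightarrow> real"
  assumes smooth: "smooth_on UNIV p"
begin

section \<open>Derivatives of the radius of curvature\<close>

definition \<rho> :: "real \<Rightarrow> real" where "\<rho> = curvature_radius p"
definition \<rho>1 :: "real \<Rightarrow> real" where "\<rho>1 = D \<rho>"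
definition \<rho>2 :: "real \<Rightarrow> real" where "\<rho>2 = D \<rho>1"
definition \<rho>3 :: "real \<Rightarrow> real" where "\<rho>3 = D \<rho>2"

lemma has_deriv_D_pow: "((D ^^ n) p has_real_derivative (D ^^ Suc n) p x) (at x)"
  using smooth vector_derivative_works[of "(D ^^ n) p" "at x"]
  by (auto simp: smooth_on_def has_real_derivative_iff_has_vector_derivative)

text \<open>\<open>D\<close> is additive on differentiable functions, hence the induction: each
  iterate for \<open>\<rho>\<close> is a sum of two iterates for \<open>p\<close>, and smoothness
  passes from \<open>p\<close> to \<open>\<rho>\<close>.\<close>

lemma rad_pow: "(D ^^ n) \<rho> = (\<lambda>x. (D ^^ n) p x + (D ^^ (n + 2)) p x)"
proof (induction n)
  case 0
  then show ?case by (simp add: \<rho>_def curvature_radius_def fun_eq_iff)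
next
  case (Suc n)
  have "((D ^^ n) \<rho> has_real_derivative (D ^^ Suc n) p x + (D ^^ (Suc n + 2)) p x) (at x)" for x
    unfolding Suc using has_deriv_D_pow[of n x] has_deriv_D_pow[of "n+2" x]
    by (auto intro!: derivative_eq_intros)
  then show ?case
    by (auto simp: fun_eq_iff has_real_derivative_iff_has_vector_derivative intro!: vector_derivative_at)
qed

lemma has_deriv_rad_pow: "((D ^^ n) \<rho> has_real_derivative (D ^^ Suc n) \<rho> x) (at x)"
proof -
  have "(D ^^ n) \<rho> differentiable (at x)"
    unfolding rad_pow using has_deriv_D_pow[of n x] has_deriv_D_pow[of "n+2" x]
    by (intro differentiable_add) (auto simp: real_differentiable_def)
  then show ?thesis
    using vector_derivative_works[of "(D ^^ n) \<rho>" "at x"]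
    by (auto simp: has_real_derivative_iff_has_vector_derivative)
qed

lemma smooth_\<rho>: "smooth_on UNIV \<rho>"
  using has_deriv_rad_pow unfolding smooth_on_def by (meson real_differentiable_def)

lemma rad_derivs:
  "(p has_real_derivative D p x) (at x)"
  "(D p has_real_derivative \<rho> x - p x) (at x)"
  "(\<rho> has_real_derivative \<rho>1 x) (at x)"
  "(\<rho>1 has_real_derivative \<rho>2 x) (at x)"
  "(\<rho>2 has_real_derivative \<rho>3 x) (at x)"
  using has_deriv_D_pow[of 0 x] has_deriv_D_pow[of 1 x]
    has_deriv_rad_pow[of 0 x] has_deriv_rad_pow[of 1 x] has_deriv_rad_pow[of 2 x]
  by (simp_all add: \<rho>1_def \<rho>2_def \<rho>3_def \<rho>_def curvature_radius_def eval_nat_numeral)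

lemmas rad_derivs' [derivative_intros] = rad_derivs(1,3-5)[THEN DERIV_chain2]

lemmas rad_has_derivative [derivative_intros] =
  rad_derivs[THEN DERIV_compose_FDERIV]
end

lemma vector_2_axis: "vector [a, b] = a *\<^sub>R axis 1 1 + b *\<^sub>R (axis 2 1 :: real^2)"
  by (simp add: vec_eq_iff forall_2 axis_def)

lemma vector_3_axis: "vector [a, b, c] = a *\<^sub>R axis 1 1 + b *\<^sub>R axis 2 1 + c *\<^sub>R (axis 3 1 :: real^3)"
  by (simp add: vec_eq_iff forall_3 axis_def)

lemma has_derivative_vector_2:
  assumes "(f1 has_derivative g1) F" "(f2 has_derivative g2) F"
  shows "((\<lambda>x. vector [f1 x, f2 x] :: real^2) has_derivative (\<lambda>v. vector [g1 v, g2 v])) F"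
  unfolding vector_2_axis using assms by (intro derivative_intros)

lemma has_derivative_vector_3:
  assumes "(f1 has_derivative g1) F" "(f2 has_derivative g2) F" "(f3 has_derivative g3) F"
  shows "((\<lambda>x. vector [f1 x, f2 x, f3 x] :: real^3) has_derivative (\<lambda>v. vector [g1 v, g2 v, g3 v])) F"
  unfolding vector_3_axis using assms by (intro derivative_intros)

context smooth_hedgehog
begin

text \<open>In the orthonormal frame \<open>t(\<theta> + \<alpha>)\<close>, \<open>n(\<theta> + \<alpha>)\<close> of the plane, the partial derivatives of the
  front are \<open>(1, u t + m n)\<close> and \<open>(0, \<mu> t)\<close>. A suffix \<open>\<alpha>\<close> or \<open>\<theta>\<close> denotes a partial derivative.\<close>

definition u :: "real \<times> real \<Rightarrow> real" where "u x = \<rho> (snd x) * cos (fst x)"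
definition m :: "real \<times> real \<Rightarrow> real" where "m x = \<rho> (snd x) * sin (fst x)"
definition u\<theta> :: "real \<times> real \<Rightarrow> real" where "u\<theta> x = \<rho>1 (snd x) * cos (fst x)"
definition \<mu> :: "real \<times> real \<Rightarrow> real" where "\<mu> x = u x + \<rho>1 (snd x) * sin (fst x)"
definition \<mu>\<alpha> :: "real \<times> real \<Rightarrow> real" where "\<mu>\<alpha> x = u\<theta> x - m x"
definition \<mu>\<theta> :: "real \<times> real \<Rightarrow> real" where "\<mu>\<theta> x = u\<theta> x + \<rho>2 (snd x) * sin (fst x)"
definition \<mu>\<alpha>\<theta> :: "real \<times> real \<Rightarrow> real" where
  "\<mu>\<alpha>\<theta> x = \<rho>2 (snd x) * cos (fst x) - \<rho>1 (snd x) * sin (fst x)"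
definition \<mu>\<theta>\<theta> :: "real \<times> real \<Rightarrow> real" where
  "\<mu>\<theta>\<theta> x = \<rho>2 (snd x) * cos (fst x) + \<rho>3 (snd x) * sin (fst x)"
definition W :: "real \<times> real \<Rightarrow> real" where "W x = 1 + (m x)\<^sup>2"

lemma W_pos [simp]: "W x > 0"
  by (simp add: W_def add_pos_nonneg)

lemma W_nz [simp]: "W x \<noteq> 0"
  by (metis W_pos less_irrefl)

text \<open>A shift of \<alpha> rotates the pair \<open>u\<close>, \<open>m\<close> and likewise the
  pair \<open>\<mu>\<close>, \<open>\<mu>\<alpha>\<close>. The \<theta>-derivative of
  \<open>m\<close> is \<rho>' sin \<alpha>, written as \<open>\<mu> x - u x\<close>.\<close>

lemma coord_derivs:
  "(u has_derivative (\<lambda>v. - m x * fst v + u\<theta> x * snd v)) (at x)"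
  "(m has_derivative (\<lambda>v. u x * fst v + (\<mu> x - u x) * snd v)) (at x)"
  "(\<mu> has_derivative (\<lambda>v. \<mu>\<alpha> x * fst v + \<mu>\<theta> x * snd v)) (at x)"
  "(\<mu>\<alpha> has_derivative (\<lambda>v. - \<mu> x * fst v + \<mu>\<alpha>\<theta> x * snd v)) (at x)"
  "(\<mu>\<theta> has_derivative (\<lambda>v. \<mu>\<alpha>\<theta> x * fst v + \<mu>\<theta>\<theta> x * snd v)) (at x)"
  "(W has_derivative (\<lambda>v. 2 * m x * (u x * fst v + (\<mu> x - u x) * snd v))) (at x)"
  unfolding u_def[abs_def] m_def[abs_def] \<mu>_def[abs_def] \<mu>\<alpha>_def[abs_def] u\<theta>_def[abs_def]
    \<mu>\<theta>_def[abs_def] \<mu>\<alpha>\<theta>_def[abs_def] \<mu>\<theta>\<theta>_def[abs_def] W_def[abs_def]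
  by (auto intro!: derivative_eq_intros simp: fun_eq_iff algebra_simps power2_eq_square)

declare coord_derivs [derivative_intros]

definition F\<alpha> :: "real \<times> real \<Rightarrow> real^3" where
  "F\<alpha> x = (let \<phi> = snd x + fst x in
     vector [1, - u x * sin \<phi> - m x * cos \<phi>, u x * cos \<phi> - m x * sin \<phi>])"
definition F\<theta> :: "real \<times> real \<Rightarrow> real^3" where
  "F\<theta> x = vector [0, - \<mu> x * sin (snd x + fst x), \<mu> x * cos (snd x + fst x)]"

lemma front_has_derivative:
  "(front p has_derivative (\<lambda>v. fst v *\<^sub>R F\<alpha> x + snd v *\<^sub>R F\<theta> x)) (at x)"
proof -
  have 1: "front p = (\<lambda>x. vector [fst x,
      p (snd x) * cos (snd x) - D p (snd x) * sin (snd x) - m x * sin (snd x + fst x),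
      p (snd x) * sin (snd x) + D p (snd x) * cos (snd x) + m x * cos (snd x + fst x)])"
    by (simp add: front_def fun_eq_iff evolutoid_def hedgehog_curve_def tvec_def m_def \<rho>_def)
  \<comment> \<open>The velocity of the hedgehog is \<rho> t(\<theta>), whereas
    \<open>F\<alpha>\<close> and \<open>F\<theta>\<close> refer to the frame at \<theta> + \<alpha>;
    so \<theta> is written as the difference of \<theta> + \<alpha> and \<alpha>.\<close>
  have s: "sin (snd x) = sin (snd x + fst x) * cos (fst x) - cos (snd x + fst x) * sin (fst x)"
          "cos (snd x) = cos (snd x + fst x) * cos (fst x) + sin (snd x + fst x) * sin (fst x)"
    by (simp_all flip: sin_diff cos_diff)
  have "(front p has_derivative (\<lambda>v. vector [fst v,
      - \<rho> (snd x) * sin (snd x) * snd v - (u x * fst v + (\<mu> x - u x) * snd v) * sin (snd x + fst x)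
         - m x * cos (snd x + fst x) * (fst v + snd v),
      \<rho> (snd x) * cos (snd x) * snd v + (u x * fst v + (\<mu> x - u x) * snd v) * cos (snd x + fst x)
         - m x * sin (snd x + fst x) * (fst v + snd v)])) (at x)"
    unfolding 1
    by (rule has_derivative_vector_3)
       (auto intro!: derivative_eq_intros simp: fun_eq_iff algebra_simps)
  then show ?thesis
    by (rule has_derivative_eq_rhs)
       (simp add: fun_eq_iff vec_eq_iff forall_3 F\<alpha>_def F\<theta>_def Let_def s u_def m_def algebra_simps)
qed

lemma frechet_front: "frechet_derivative (front p) (at x) v = fst v *\<^sub>R F\<alpha> x + snd v *\<^sub>R F\<theta> x"
  by (simp flip: frechet_derivative_at[OF front_has_derivative])

lemma inner_F:
  "F\<alpha> x \<bullet> F\<alpha> x = 1 + (u x)\<^sup>2 + (m x)\<^sup>2"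
  "F\<alpha> x \<bullet> F\<theta> x = u x * \<mu> x" "F\<theta> x \<bullet> F\<alpha> x = u x * \<mu> x"
  "F\<theta> x \<bullet> F\<theta> x = (\<mu> x)\<^sup>2"
proof -
  define S C where "S = sin (snd x + fst x)" and "C = cos (snd x + fst x)"
  let ?c = "C\<^sup>2 + S\<^sup>2"
  have "F\<alpha> x \<bullet> F\<alpha> x = 1 + ((u x)\<^sup>2 + (m x)\<^sup>2) * ?c" "F\<alpha> x \<bullet> F\<theta> x = u x * \<mu> x * ?c"
    "F\<theta> x \<bullet> F\<theta> x = (\<mu> x)\<^sup>2 * ?c"
    unfolding F\<alpha>_def F\<theta>_def Let_def inner_vec_def sum_3 S_def[symmetric] C_def[symmetric]
    by (simp_all add: power2_eq_square algebra_simps)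
  then show "F\<alpha> x \<bullet> F\<alpha> x = 1 + (u x)\<^sup>2 + (m x)\<^sup>2"
    "F\<alpha> x \<bullet> F\<theta> x = u x * \<mu> x" "F\<theta> x \<bullet> F\<alpha> x = u x * \<mu> x"
    "F\<theta> x \<bullet> F\<theta> x = (\<mu> x)\<^sup>2"
    by (simp_all add: inner_commute S_def C_def)
qed

lemma first_fundamental_form_front:
  "first_fundamental_form (front p) x v w =
     (1 + (u x)\<^sup>2 + (m x)\<^sup>2) * (fst v * fst w) + u x * \<mu> x * (fst v * snd w + snd v * fst w)
     + (\<mu> x)\<^sup>2 * (snd v * snd w)"
  by (simp add: first_fundamental_form_def frechet_front inner_add_left inner_add_right inner_F algebra_simps)

lemma front_normal_eq: "front_normal p x = (1 / sqrt (W x)) *\<^sub>R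
   vector [- m x, - cos (snd x + fst x), - sin (snd x + fst x)]"
  by (cases x) (simp add: front_normal_def Let_def nvec_def m_def W_def \<rho>_def power_mult_distrib)

lemma det3_vector:
  "det3 (vector [a1, a2, a3]) (vector [b1, b2, b3]) (r *\<^sub>R vector [c1, c2, c3]) =
   r * (a1 * (b2 * c3 - b3 * c2) - a2 * (b1 * c3 - b3 * c1) + a3 * (b1 * c2 - b2 * c1))"
  by (simp add: det3_def det_3 algebra_simps)

lemma det3_F_normal: "det3 (F\<alpha> x) (F\<theta> x) (front_normal p x) = \<mu> x * sqrt (W x)"
proof -
  define S C where "S = sin (snd x + fst x)" and "C = cos (snd x + fst x)"
  have "det3 (F\<alpha> x) (F\<theta> x) (front_normal p x) = 1 / sqrt (W x) * (\<mu> x * (C\<^sup>2 + S\<^sup>2) * W x)"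
    unfolding F\<alpha>_def F\<theta>_def Let_def front_normal_eq S_def[symmetric] C_def[symmetric] det3_vector
    by (simp add: W_def power2_eq_square algebra_simps)
  also have "\<dots> = \<mu> x * sqrt (W x)"
    by (simp add: S_def C_def real_div_sqrt less_imp_le flip: times_divide_eq_right)
  finally show ?thesis .
qed

lemma area_density_eq: "area_density p x = \<mu> x * sqrt (W x)"
  by (simp add: area_density_def frechet_front det3_F_normal)

lemma area_density_zero_iff: "area_density p x = 0 \<longleftrightarrow> \<mu> x = 0"
  by (simp add: area_density_eq)

text \<open>The product rule leaves d\<mu> times sqrt W, as the other term carries the vanishing
  factor \<mu>.\<close>

lemma frechet_area_density:
  assumes "\<mu> x = 0"
  shows "frechet_derivative (area_density p) (at x) v = (\<mu>\<alpha> x * fst v + \<mu>\<theta> x * snd v) * sqrt (W x)"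
proof -
  have "(area_density p has_derivative (\<lambda>v. (\<mu>\<alpha> x * fst v + \<mu>\<theta> x * snd v) * sqrt (W x))) (at x)"
    unfolding area_density_eq[abs_def] using assms
    by (auto intro!: derivative_eq_intros simp: fun_eq_iff)
  from frechet_derivative_at[OF this, symmetric] show ?thesis by simp
qed

lemma F\<alpha>_nz: "F\<alpha> x \<noteq> 0"
  by (auto simp: F\<alpha>_def Let_def vec_eq_iff forall_3)

text \<open>At a singular point \<open>F\<theta>\<close> vanishes, while \<open>F\<alpha>\<close>
  never does because its first entry is 1; the null direction is the \<theta>-axis.\<close>

lemma null_vector_iff:
  assumes "\<mu> x = 0"
  shows "frechet_derivative (front p) (at x) v = 0 \<longleftrightarrow> fst v = 0"
  using assms F\<alpha>_nz[of x] by (auto simp: frechet_front F\<theta>_def vec_eq_iff forall_3)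

text \<open>With the \<theta>-axis as null direction, transversality to \<Sigma> is the nonvanishing
  of the \<theta>-derivative of \<lambda>, on \<Sigma> a positive multiple of
  \<open>\<mu>\<theta>\<close>; d\<lambda> is then nonzero as well.\<close>

lemma A2_points_eq: "A2_points k p = {x \<in> front_domain k. \<mu> x = 0 \<and> \<mu>\<theta> x \<noteq> 0}"
proof -
  have "((\<exists>v. frechet_derivative (area_density p) (at x) v \<noteq> 0) \<and>
     (\<forall>v. frechet_derivative (front p) (at x) v = 0 \<and> v \<noteq> 0 \<longrightarrow>
          frechet_derivative (area_density p) (at x) v \<noteq> 0)) \<longleftrightarrow> \<mu>\<theta> x \<noteq> 0" (is "?L \<longleftrightarrow> _") if "\<mu> x = 0" for x
  proof
    assume ?L
    moreover have "frechet_derivative (front p) (at x) (0, 1) = 0" "(0, 1) \<noteq> (0 :: real \<times> real)"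
      using that by (simp_all add: null_vector_iff zero_prod_def)
    ultimately have "frechet_derivative (area_density p) (at x) (0, 1) \<noteq> 0"
      by blast
    then show "\<mu>\<theta> x \<noteq> 0"
      using that by (simp add: frechet_area_density)
  next
    assume nz: "\<mu>\<theta> x \<noteq> 0"
    then have "frechet_derivative (area_density p) (at x) (0, 1) \<noteq> 0"
      using that by (simp add: frechet_area_density)
    moreover have "frechet_derivative (area_density p) (at x) v \<noteq> 0"
      if "frechet_derivative (front p) (at x) v = 0" "v \<noteq> 0" for v
      using that nz \<open>\<mu> x = 0\<close>
      by (simp add: null_vector_iff frechet_area_density prod_eq_iff)
    ultimately show ?L
      by blast
  qed
  then show ?thesis
    unfolding A2_points_def singular_set_def area_density_zero_iff by blast
qed

section \<open>Gaussian curvature\<close>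

abbreviation g where "g \<equiv> first_fundamental_form (front p)"

text \<open>The tangential part of the second derivative of the front along constant fields \<open>X\<close>, \<open>Y\<close>.\<close>

definition koszul :: "real \<times> real \<Rightarrow> real \<times> real \<Rightarrow> real \<times> real \<Rightarrow> real \<times> real" where
  "koszul x X Y =
    (let A = m x / W x; a = fst X * fst Y; b = fst X * snd Y + snd X * fst Y; c = snd X * snd Y;
         N = 2 * u x * A * a + \<mu> x * A * (b + c)
     in (N, (- 2 * m x * a + \<mu>\<alpha> x * b + \<mu>\<theta> x * c - u x * N) / \<mu> x))"

lemma frechet_g:
  "frechet_derivative (\<lambda>y. g y Y Z) (at x) X =
     (let u' = - m x * fst X + u\<theta> x * snd X; m' = u x * fst X + (\<mu> x - u x) * snd X;
          \<mu>' = \<mu>\<alpha> x * fst X + \<mu>\<theta> x * snd X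
      in (2 * u x * u' + 2 * m x * m') * (fst Y * fst Z)
       + (u' * \<mu> x + u x * \<mu>') * (fst Y * snd Z + snd Y * fst Z)
       + 2 * \<mu> x * \<mu>' * (snd Y * snd Z))"
proof -
  have "((\<lambda>y. g y Y Z) has_derivative (\<lambda>X.
     (let u' = - m x * fst X + u\<theta> x * snd X; m' = u x * fst X + (\<mu> x - u x) * snd X;
          \<mu>' = \<mu>\<alpha> x * fst X + \<mu>\<theta> x * snd X
      in (2 * u x * u' + 2 * m x * m') * (fst Y * fst Z)
       + (u' * \<mu> x + u x * \<mu>') * (fst Y * snd Z + snd Y * fst Z)
       + 2 * \<mu> x * \<mu>' * (snd Y * snd Z)))) (at x)"
    unfolding first_fundamental_form_front Let_def
    by (rule derivative_eq_intros refl | simp add: fun_eq_iff algebra_simps)+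
  from frechet_derivative_at[OF this, symmetric] show ?thesis by simp
qed

text \<open>Completing the square, g(v, w) = W v1 w1 + (u v1 + \<mu> v2)(u w1 + \<mu> w2). For v =
  \<open>koszul x X Y\<close> the denominators W and \<mu> cancel in the respective
  summands.\<close>

lemma g_koszul:
  assumes "\<mu> x \<noteq> 0"
  shows "g x (koszul x X Y) Z =
    m x * (2 * u x * (fst X * fst Y) + \<mu> x * (fst X * snd Y + snd X * fst Y + snd X * snd Y)) * fst Z
    + (- 2 * m x * (fst X * fst Y) + \<mu>\<alpha> x * (fst X * snd Y + snd X * fst Y) + \<mu>\<theta> x * (snd X * snd Y))
      * (u x * fst Z + \<mu> x * snd Z)"
proof -
  define N where "N = fst (koszul x X Y)"
  define Q where "Q = - 2 * m x * (fst X * fst Y) + \<mu>\<alpha> x * (fst X * snd Y + snd X * fst Y) + \<mu>\<theta> x * (snd X * snd Y)"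
  have NQ: "koszul x X Y = (N, (Q - u x * N) / \<mu> x)"
    by (simp add: koszul_def Let_def N_def Q_def)
  have N: "W x * N = m x * (2 * u x * (fst X * fst Y) + \<mu> x * (fst X * snd Y + snd X * fst Y + snd X * snd Y))"
    by (simp add: koszul_def Let_def N_def field_simps)
  have "g x (koszul x X Y) Z = (W x * N) * fst Z + Q * (u x * fst Z + \<mu> x * snd Z)"
    using assms by (simp add: first_fundamental_form_front NQ W_def field_simps power2_eq_square)
  then show ?thesis by (simp only: Q_def N)
qed

lemma g_definite:
  assumes "\<mu> x \<noteq> 0" "g x v v = 0"
  shows "v = 0"
proof -
  have "g x v v = W x * (fst v)\<^sup>2 + (u x * fst v + \<mu> x * snd v)\<^sup>2"
    by (simp add: first_fundamental_form_front W_def power2_eq_square algebra_simps)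
  moreover have "W x * (fst v)\<^sup>2 \<ge> 0" by (simp add: less_imp_le)
  ultimately have "W x * (fst v)\<^sup>2 = 0" "(u x * fst v + \<mu> x * snd v)\<^sup>2 = 0"
    using assms(2) by (smt (verit) zero_le_power2)+
  then show ?thesis using assms(1) by (auto simp: prod_eq_iff)
qed

lemma g_diff_left: "g x (v - w) z = g x v z - g x w z"
  by (simp add: first_fundamental_form_front algebra_simps)

text \<open>\<open>koszul\<close> solves the Koszul equation by a polynomial identity, and
  definiteness of \<open>g\<close> off \<Sigma> makes the solution unique, as \<open>THE\<close>
  requires.\<close>

lemma levi_civita_front:
  assumes "\<mu> x \<noteq> 0"
  shows "levi_civita g x X Y = koszul x X Y"
  unfolding levi_civita_def
proof (rule the_equality)
  have E: "2 * g x (koszul x X Y) Z =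
     frechet_derivative (\<lambda>y. g y Y Z) (at x) X +
     frechet_derivative (\<lambda>y. g y X Z) (at x) Y -
     frechet_derivative (\<lambda>y. g y X Y) (at x) Z" for Z
    unfolding frechet_g g_koszul[OF assms] Let_def u\<theta>_def[symmetric]
    by (simp add: algebra_simps \<mu>\<alpha>_def)
  then show "\<forall>Z. 2 * g x (koszul x X Y) Z =
     frechet_derivative (\<lambda>y. g y Y Z) (at x) X +
     frechet_derivative (\<lambda>y. g y X Z) (at x) Y -
     frechet_derivative (\<lambda>y. g y X Y) (at x) Z" ..
  fix V
  assume "\<forall>Z. 2 * g x V Z =
     frechet_derivative (\<lambda>y. g y Y Z) (at x) X +
     frechet_derivative (\<lambda>y. g y X Z) (at x) Y -
     frechet_derivative (\<lambda>y. g y X Y) (at x) Z"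
  with E have "g x V Z = g x (koszul x X Y) Z" for Z
    by (metis mult_left_cancel zero_neq_numeral)
  then have "g x (V - koszul x X Y) (V - koszul x X Y) = 0"
    by (simp add: g_diff_left)
  then show "V = koszul x X Y"
    using g_definite[OF assms, of "V - koszul x X Y"] by simp
qed

lemma open_regular: "open {x. \<mu> x \<noteq> 0}"
proof -
  have "continuous_on UNIV \<mu>"
    using coord_derivs(3) by (meson continuous_at_imp_continuous_on has_derivative_continuous)
  then show ?thesis
    by (simp add: open_Collect_neq)
qed

text \<open>The complement of \<Sigma> is open, so the formula for \<open>levi_civita\<close>,
  established there only, may be differentiated at a regular point.\<close>

lemma frechet_levi_civita_front:
  assumes "\<mu> x \<noteq> 0" "((\<lambda>y. koszul y X Y) has_derivative f) (at x)"
  shows "frechet_derivative (\<lambda>y. levi_civita g y X Y) (at x) Z = f Z"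
proof -
  have "((\<lambda>y. levi_civita g y X Y) has_derivative f) (at x)"
    by (rule has_derivative_transform_within_open[OF assms(2) open_regular])
       (use assms(1) in \<open>auto simp: levi_civita_front\<close>)
  from frechet_derivative_at[OF this, symmetric] show ?thesis by simp
qed

lemma m_div_W_has_derivative:
  "((\<lambda>y. m y / W y) has_derivative
    (\<lambda>v. (u x * fst v + (\<mu> x - u x) * snd v) * ((1 - (m x)\<^sup>2) / (W x)\<^sup>2))) (at x)"
  by (rule derivative_eq_intros refl W_nz)+
     (simp add: fun_eq_iff field_simps power2_eq_square W_def)

lemma front_curvature_eq:
  assumes "\<mu> x \<noteq> 0"
  shows "front_curvature p x = (2 * u x - \<mu> x) / (\<mu> x * (W x)\<^sup>2)"
proof -
  define A where "A = (\<lambda>y. m y / W y)"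
  define B where "B = (1 - (m x)\<^sup>2) / (W x)\<^sup>2"
  have A': "(A has_derivative (\<lambda>v. (u x * fst v + (\<mu> x - u x) * snd v) * B)) (at x)"
    unfolding A_def B_def by (rule m_div_W_has_derivative)
  have YY: "koszul y (0, 1) (0, 1) = (\<mu> y * A y, (\<mu>\<theta> y - u y * (\<mu> y * A y)) / \<mu> y)"
    and XY: "koszul y (1, 0) (0, 1) = (\<mu> y * A y, (\<mu>\<alpha> y - u y * (\<mu> y * A y)) / \<mu> y)" for y
    by (simp_all add: koszul_def A_def Let_def)
  have 1: "((\<lambda>y. koszul y (0, 1) (0, 1)) has_derivative (\<lambda>v.
     let a = A x; u' = - m x * fst v + u\<theta> x * snd v; \<mu>' = \<mu>\<alpha> x * fst v + \<mu>\<theta> x * snd v;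
         a' = (u x * fst v + (\<mu> x - u x) * snd v) * B
     in (\<mu>' * a + \<mu> x * a', (\<mu>\<alpha>\<theta> x * fst v + \<mu>\<theta>\<theta> x * snd v) / \<mu> x
          - \<mu>\<theta> x * \<mu>' / (\<mu> x)\<^sup>2 - u' * a - u x * a'))) (at x)"
    unfolding YY Let_def using assms A'
    by (auto intro!: derivative_eq_intros has_derivative_Pair simp: fun_eq_iff divide_simps)
       (simp add: power2_eq_square algebra_simps)
  have 2: "((\<lambda>y. koszul y (1, 0) (0, 1)) has_derivative (\<lambda>v.
     let a = A x; u' = - m x * fst v + u\<theta> x * snd v; \<mu>' = \<mu>\<alpha> x * fst v + \<mu>\<theta> x * snd v;
         a' = (u x * fst v + (\<mu> x - u x) * snd v) * B
     in (\<mu>' * a + \<mu> x * a', (- \<mu> x * fst v + \<mu>\<alpha>\<theta> x * snd v) / \<mu> x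
          - \<mu>\<alpha> x * \<mu>' / (\<mu> x)\<^sup>2 - u' * a - u x * a'))) (at x)"
    unfolding XY Let_def using assms A'
    by (auto intro!: derivative_eq_intros has_derivative_Pair simp: fun_eq_iff divide_simps)
       (simp add: power2_eq_square algebra_simps)
  \<comment> \<open>\<open>B\<close> is the derivative of m / (1 + m^2) with respect to m. In the
    curvature, \<open>A\<close> and \<open>B\<close> enter only through this combination.\<close>
  have AB: "B + (A x)\<^sup>2 = 1 / (W x)\<^sup>2"
    by (simp add: A_def B_def power_divide add_divide_distrib[symmetric])
  have m: "m x = u\<theta> x - \<mu>\<alpha> x" by (simp add: \<mu>\<alpha>_def)
  \<comment> \<open>A variable k subject to \<mu> k = 1 replaces division by \<mu>, so that the
    curvature components become polynomials within reach of \<open>algebra\<close>.\<close>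
  define k where "k = 1 / \<mu> x"
  have k: "\<mu> x * k = 1" and div: "z / \<mu> x = z * k" "z / (\<mu> x)\<^sup>2 = z * k * k" for z
    using assms by (simp_all add: k_def power2_eq_square)
  have koszul: "koszul x X Y = (let a = fst X * fst Y; b = fst X * snd Y + snd X * fst Y; c = snd X * snd Y;
         N = 2 * u x * A x * a + \<mu> x * A x * (b + c)
     in (N, (- 2 * m x * a + \<mu>\<alpha> x * b + \<mu>\<theta> x * c - u x * N) * k))" for X Y
    by (simp add: koszul_def A_def Let_def k_def)
  \<comment> \<open>The vector is a multiple of (\<mu>, -u), which is \<open>g\<close>-orthogonal to
    (0, 1), in accordance with the antisymmetry of the curvature tensor.\<close>
  have R: "riemann_curvature g x (1, 0) (0, 1) (0, 1) =
    (\<mu> x * (2 * u x - \<mu> x) * (B + (A x)\<^sup>2), - u x * (2 * u x - \<mu> x) * (B + (A x)\<^sup>2))"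
    unfolding riemann_curvature_def frechet_levi_civita_front[OF assms 1]
      frechet_levi_civita_front[OF assms 2] levi_civita_front[OF assms] koszul Let_def div
      prod_eq_iff fst_add snd_add fst_diff snd_diff fst_conv snd_conv
    using k m by (intro conjI; algebra)
  have g1: "g x (\<mu> x * r * s, - u x * r * s) (1, 0) = W x * (\<mu> x * r * s)" for r s
    by (simp add: first_fundamental_form_front W_def algebra_simps power2_eq_square)
  have g2: "g x (1, 0) (1, 0) * g x (0, 1) (0, 1) - (g x (1, 0) (0, 1))\<^sup>2 = (\<mu> x)\<^sup>2 * W x"
    by (simp add: first_fundamental_form_front W_def algebra_simps power2_eq_square)
  have "front_curvature p x = W x * (\<mu> x * (2 * u x - \<mu> x) * (1 / (W x)\<^sup>2)) / ((\<mu> x)\<^sup>2 * W x)"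
    unfolding front_curvature_def gaussian_curvature_def Let_def R AB g1 g2 ..
  also have "\<dots> = (2 * u x - \<mu> x) / (\<mu> x * (W x)\<^sup>2)"
    using assms by (simp add: power2_eq_square)
  finally show ?thesis .
qed

end

section \<open>Smooth functions and their zeros\<close>

text \<open>Bounding the order permits induction: \<open>D f\<close> has one order less than
  \<open>f\<close>, and closure under sums, products and inverses follows from the differentiation
  rules.\<close>

definition smooth_upto :: "nat \<Rightarrow> real set \<Rightarrow> (real \<Rightarrow> 'a::real_normed_vector) \<Rightarrow> bool" where
  "smooth_upto n U f \<longleftrightarrow> (\<forall>i<n. \<forall>s\<in>U. (D ^^ i) f differentiable (at s))"

lemma smooth_on_iff_upto: "smooth_on U f \<longleftrightarrow> (\<forall>n. smooth_upto n U f)"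
  unfolding smooth_on_def smooth_upto_def by blast

lemma smooth_upto_0 [simp]: "smooth_upto 0 U f"
  by (simp add: smooth_upto_def)

lemma smooth_upto_Suc:
  "smooth_upto (Suc n) U f \<longleftrightarrow> (\<forall>s\<in>U. f differentiable (at s)) \<and> smooth_upto n U (D f)"
  by (simp add: smooth_upto_def All_less_Suc2 funpow_Suc_right del: funpow.simps)

lemma smooth_upto_SucD: "smooth_upto (Suc n) U f \<Longrightarrow> smooth_upto n U f"
  by (simp add: smooth_upto_def)

lemma differentiable_cong_open:
  assumes "open U" "s \<in> U" "\<And>x. x \<in> U \<Longrightarrow> f x = g x" "f differentiable (at s)"
  shows "g differentiable (at s)" "D g s = D f s"
proof -
  from assms(4) have "(f has_vector_derivative D f s) (at s)"
    by (simp add: vector_derivative_works)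
  then have "(g has_vector_derivative D f s) (at s)"
    by (rule has_vector_derivative_transform_within_open) (use assms in auto)
  then show "g differentiable (at s)" "D g s = D f s"
    by (auto intro: differentiableI_vector vector_derivative_at)
qed

lemma smooth_upto_cong:
  assumes "open U" "\<And>x. x \<in> U \<Longrightarrow> f x = g x" "smooth_upto n U f"
  shows "smooth_upto n U g"
  using assms
proof (induction n arbitrary: f g)
  case (Suc n)
  have "g differentiable (at s)" "D f s = D g s" if "s \<in> U" for s
    using differentiable_cong_open[OF Suc.prems(1) that, of f g] Suc.prems that
    by (auto simp: smooth_upto_Suc)
  then show ?case
    using Suc.prems(3) Suc.IH[OF Suc.prems(1), of "D f" "D g"] by (simp add: smooth_upto_Suc)
qed simp

text \<open>A derivative formula on \<open>U\<close> determines \<open>D f\<close> only there; as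
  \<open>U\<close> is open, all higher derivatives at its points are determined too.\<close>

lemma smooth_upto_SucI:
  assumes "open U" "\<And>s. s \<in> U \<Longrightarrow> (f has_vector_derivative f' s) (at s)" "smooth_upto n U f'"
  shows "smooth_upto (Suc n) U f"
  unfolding smooth_upto_Suc
  using assms smooth_upto_cong[OF assms(1) _ assms(3), of "D f"]
  by (auto intro: differentiableI_vector vector_derivative_at[symmetric])

lemma smooth_upto_SucE:
  assumes "smooth_upto (Suc n) U f"
  shows "s \<in> U \<Longrightarrow> (f has_vector_derivative D f s) (at s)" "smooth_upto n U (D f)" "smooth_upto n U f"
  using assms smooth_upto_SucD by (auto simp: smooth_upto_Suc vector_derivative_works)

lemma smooth_upto_const: "open U \<Longrightarrow> smooth_upto n U (\<lambda>x. c)"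
proof (induction n arbitrary: c)
  case (Suc n)
  show ?case by (rule smooth_upto_SucI[where f' = "\<lambda>x. 0"]) (auto intro: Suc)
qed simp

lemma smooth_upto_ident: "open U \<Longrightarrow> smooth_upto n U (\<lambda>x. x)"
  by (cases n) (auto intro!: smooth_upto_SucI[where f' = "\<lambda>x. 1"] smooth_upto_const)

lemma smooth_upto_add:
  assumes "open U" "smooth_upto n U f" "smooth_upto n U g"
  shows "smooth_upto n U (\<lambda>x. f x + g x)"
  using assms
proof (induction n arbitrary: f g)
  case (Suc n)
  note f = smooth_upto_SucE[OF Suc.prems(2)] and g = smooth_upto_SucE[OF Suc.prems(3)]
  show ?case
    by (rule smooth_upto_SucI[OF Suc.prems(1) has_vector_derivative_add[OF f(1) g(1)]])
       (auto intro: Suc.IH Suc.prems(1) f g)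
qed simp

lemma smooth_upto_mult:
  fixes f g :: "real \<Rightarrow> real"
  assumes "open U" "smooth_upto n U f" "smooth_upto n U g"
  shows "smooth_upto n U (\<lambda>x. f x * g x)"
  using assms
proof (induction n arbitrary: f g)
  case (Suc n)
  note f = smooth_upto_SucE[OF Suc.prems(2)] and g = smooth_upto_SucE[OF Suc.prems(3)]
  show ?case
    by (rule smooth_upto_SucI[OF Suc.prems(1) has_vector_derivative_mult[OF f(1) g(1)]])
       (auto intro!: smooth_upto_add Suc.IH Suc.prems(1) f g)
qed simp

lemma smooth_upto_inverse:
  fixes f :: "real \<Rightarrow> real"
  assumes "open U" "smooth_upto n U f" "\<And>x. x \<in> U \<Longrightarrow> f x \<noteq> 0"
  shows "smooth_upto n U (\<lambda>x. inverse (f x))"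
  using assms
proof (induction n)
  case (Suc n)
  note f = smooth_upto_SucE[OF Suc.prems(2)]
  have "smooth_upto n U (\<lambda>x. inverse (f x) * inverse (f x))"
    by (rule smooth_upto_mult) (use Suc f in auto)
  then have "smooth_upto n U (\<lambda>x. D f x * (inverse (f x) * inverse (f x)))"
    by (rule smooth_upto_mult[OF Suc.prems(1) f(2)])
  then have "smooth_upto n U (\<lambda>x. (- 1) * (D f x * (inverse (f x) * inverse (f x))))"
    by (rule smooth_upto_mult[OF Suc.prems(1) smooth_upto_const[OF Suc.prems(1)]])
  moreover have "((\<lambda>x. inverse (f x)) has_vector_derivative (- 1) * (D f s * (inverse (f s) * inverse (f s)))) (at s)"
    if "s \<in> U" for s
    using DERIV_inverse'[of f "D f s" s UNIV] f(1)[OF that] Suc.prems(3)[OF that]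
    by (simp add: has_real_derivative_iff_has_vector_derivative mult_ac)
  ultimately show ?case
    by (intro smooth_upto_SucI[OF Suc.prems(1)])
qed simp

lemma smooth_upto_Pair:
  assumes "open U" "smooth_upto n U f" "smooth_upto n U g"
  shows "smooth_upto n U (\<lambda>x. (f x, g x))"
  using assms
proof (induction n arbitrary: f g)
  case (Suc n)
  note f = smooth_upto_SucE[OF Suc.prems(2)] and g = smooth_upto_SucE[OF Suc.prems(3)]
  show ?case
    by (rule smooth_upto_SucI[OF Suc.prems(1) has_vector_derivative_Pair[OF f(1) g(1)]])
       (auto intro!: Suc.IH Suc.prems(1) f g)
qed simp

text \<open>Infinitely many zeros in a compact interval accumulate at a point, which is a zero by
  continuity. The difference quotients along the zeros vanish, and so does the derivative at that
  point.\<close>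

lemma finite_simple_zeros:
  fixes f f' :: "real \<Rightarrow> real"
  assumes "\<And>x. (f has_real_derivative f' x) (at x)" "\<And>x. f x = 0 \<Longrightarrow> f' x \<noteq> 0"
  shows "finite {x \<in> {a..b}. f x = 0}"
proof (rule ccontr)
  assume "infinite {x \<in> {a..b}. f x = 0}"
  then obtain x where x: "x \<in> {a..b}" "x islimpt {x \<in> {a..b}. f x = 0}"
    using compact_eq_Bolzano_Weierstrass[of "{a..b}"] by blast
  have "isCont f y" for y using assms(1) DERIV_isCont by blast
  then have "closed {y. f y = 0}"
    by (intro closed_Collect_eq) (auto simp: continuous_on_eq_continuous_at)
  moreover have "x islimpt {y. f y = 0}"
    using x(2) by (rule islimpt_subset) auto
  ultimately have "f x = 0"
    by (auto simp: closed_limpt)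
  from x(2) obtain X where X: "\<And>n::nat. X n \<in> {x \<in> {a..b}. f x = 0} - {x}" "X \<longlonglongrightarrow> x"
    unfolding islimpt_sequential by blast
  have "((\<lambda>y. (f y - f x) / (y - x)) \<longlongrightarrow> f' x) (at x)"
    using assms(1)[of x] by (simp add: has_field_derivative_iff)
  moreover have "filterlim X (at x) sequentially"
    using X by (auto simp: filterlim_at)
  ultimately have "(\<lambda>n. (f (X n) - f x) / (X n - x)) \<longlonglongrightarrow> f' x"
    by (rule filterlim_compose)
  moreover have "(f (X n) - f x) / (X n - x) = 0" for n
    using X(1)[of n] \<open>f x = 0\<close> by auto
  ultimately have "f' x = 0"
    by (simp add: LIMSEQ_const_iff)
  with \<open>f x = 0\<close> assms(2) show False by blast
qed

section \<open>The moving frame of the plane\<close>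

lemma tvec_has_vector_derivative: "(tvec has_vector_derivative nvec \<theta>) (at \<theta>)"
  unfolding tvec_def[abs_def] nvec_def[abs_def] has_vector_derivative_def
  by (rule has_derivative_eq_rhs, rule has_derivative_vector_2)
     (auto intro!: derivative_eq_intros simp: fun_eq_iff vec_eq_iff forall_2)

lemma nvec_has_vector_derivative: "(nvec has_vector_derivative - tvec \<theta>) (at \<theta>)"
  unfolding tvec_def[abs_def] nvec_def[abs_def] has_vector_derivative_def
  by (rule has_derivative_eq_rhs, rule has_derivative_vector_2)
     (auto intro!: derivative_eq_intros simp: fun_eq_iff vec_eq_iff forall_2)

text \<open>Product rule with t' = n and n' = -t; curves can then be differentiated through their
  frame coefficients.\<close>

lemma frame_has_vector_derivative:
  assumes "(A has_real_derivative A') (at \<theta>)" "(B has_real_derivative B') (at \<theta>)"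
  shows "((\<lambda>\<theta>. A \<theta> *\<^sub>R tvec \<theta> + B \<theta> *\<^sub>R nvec \<theta>) has_vector_derivative
    (A' - B \<theta>) *\<^sub>R tvec \<theta> + (A \<theta> + B') *\<^sub>R nvec \<theta>) (at \<theta>)"
  by (rule has_vector_derivative_eq_rhs,
      rule has_vector_derivative_add[OF has_vector_derivative_scaleR has_vector_derivative_scaleR,
        OF assms(1) tvec_has_vector_derivative assms(2) nvec_has_vector_derivative])
     (simp add: algebra_simps)

section \<open>Consequences of genericity\<close>

locale generic_front = smooth_hedgehog +
  assumes generic: "generic_hedgehog p"
begin

lemma hedgehog_frame: "hedgehog_curve p \<theta> = D p \<theta> *\<^sub>R tvec \<theta> + (- p \<theta>) *\<^sub>R nvec \<theta>"
  by (simp add: hedgehog_curve_def tvec_def nvec_def vec_eq_iff forall_2)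

definition r2 :: "real \<Rightarrow> real" where "r2 \<theta> = (\<rho> \<theta>)\<^sup>2 + (\<rho>1 \<theta>)\<^sup>2"
text \<open>Minus the Wronskian of \<rho> and \<rho>'. It measures the rotation of (\<rho>, \<rho>')
  and hence the slope of the singular curve over the \<theta>-axis.\<close>

definition q :: "real \<Rightarrow> real" where "q \<theta> = (\<rho>1 \<theta>)\<^sup>2 - \<rho> \<theta> * \<rho>2 \<theta>"

text \<open>The hedgehog has velocity \<rho> t and acceleration \<rho>' t + \<rho> n. At a common
  zero of \<rho> and \<rho>' both vanish, which no cusp allows.\<close>

lemma r2_pos [simp]: "r2 \<theta> > 0"
proof (rule ccontr)
  assume "\<not> r2 \<theta> > 0"
  then have z: "\<rho> \<theta> = 0" "\<rho>1 \<theta> = 0"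
    by (auto simp: r2_def not_less sum_power2_le_zero_iff)
  have 1: "D (hedgehog_curve p) = (\<lambda>\<theta>. \<rho> \<theta> *\<^sub>R tvec \<theta> + 0 *\<^sub>R nvec \<theta>)"
    unfolding hedgehog_frame[abs_def]
    by (rule ext, rule vector_derivative_at,
        rule has_vector_derivative_eq_rhs[OF frame_has_vector_derivative[OF rad_derivs(2)]])
       (auto intro!: derivative_eq_intros rad_derivs)
  have 2: "D (D (hedgehog_curve p)) \<theta> = \<rho>1 \<theta> *\<^sub>R tvec \<theta> + \<rho> \<theta> *\<^sub>R nvec \<theta>"
    unfolding 1
    by (rule vector_derivative_at,
        rule has_vector_derivative_eq_rhs[OF frame_has_vector_derivative[OF rad_derivs(3)]])
       (auto intro!: derivative_eq_intros)
  have "D (hedgehog_curve p) \<theta> = 0"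
    using fun_cong[OF 1, of \<theta>] by (simp add: z)
  then have "cusp_at (hedgehog_curve p) \<theta>"
    using generic by (simp add: generic_hedgehog_def at_most_cusps_def)
  then show False
    using dependent_zero by (auto simp: cusp_at_def Let_def 2 z)
qed

lemma r2_nz [simp]: "r2 \<theta> \<noteq> 0"
  by (metis r2_pos less_irrefl)

lemma r2_deriv [derivative_intros]:
  "(r2 has_real_derivative 2 * \<rho> \<theta> * \<rho>1 \<theta> + 2 * \<rho>1 \<theta> * \<rho>2 \<theta>) (at \<theta>)"
  unfolding r2_def[abs_def] by (auto intro!: derivative_eq_intros)

lemma q_deriv: "(q has_real_derivative \<rho>1 \<theta> * \<rho>2 \<theta> - \<rho> \<theta> * \<rho>3 \<theta>) (at \<theta>)"
  unfolding q_def[abs_def] by (auto intro!: derivative_eq_intros)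

lemma ses_frame: "ses_curve p \<theta> =
   (D p \<theta> - (\<rho> \<theta>)\<^sup>2 * \<rho>1 \<theta> / r2 \<theta>) *\<^sub>R tvec \<theta> + (- p \<theta> + (\<rho> \<theta>)^3 / r2 \<theta>) *\<^sub>R nvec \<theta>"
  by (simp add: ses_curve_def Let_def hedgehog_frame r2_def \<rho>1_def \<rho>_def[symmetric]
      scaleR_diff_right scaleR_diff_left scaleR_add_left)

lemma q_simple_zeros:
  assumes "q \<theta> = 0"
  shows "\<rho>1 \<theta> * \<rho>2 \<theta> - \<rho> \<theta> * \<rho>3 \<theta> \<noteq> 0"
proof
  \<comment> \<open>The velocity of the singular evolutoids set is \<open>q\<close> times a smooth vector field, so at a double
    zero of \<open>q\<close> its first two derivatives vanish, which no cusp allows.\<close>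
  assume q': "\<rho>1 \<theta> * \<rho>2 \<theta> - \<rho> \<theta> * \<rho>3 \<theta> = 0"
  define A where "A = (\<lambda>\<theta>. - (\<rho> \<theta> * ((\<rho>1 \<theta>)\<^sup>2 - (\<rho> \<theta>)\<^sup>2) / (r2 \<theta>)\<^sup>2))"
  define B where "B = (\<lambda>\<theta>. 2 * (\<rho> \<theta>)\<^sup>2 * \<rho>1 \<theta> / (r2 \<theta>)\<^sup>2)"
  have 1: "D (ses_curve p) \<theta> = (q \<theta> * A \<theta>) *\<^sub>R tvec \<theta> + (q \<theta> * B \<theta>) *\<^sub>R nvec \<theta>" for \<theta>
  proof -
    let ?d = "2 * \<rho> \<theta> * \<rho>1 \<theta> + 2 * \<rho>1 \<theta> * \<rho>2 \<theta>"
    have a: "((\<lambda>\<theta>. D p \<theta> - (\<rho> \<theta>)\<^sup>2 * \<rho>1 \<theta> / r2 \<theta>) has_real_derivative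
        \<rho> \<theta> - p \<theta> - ((2 * \<rho> \<theta> * (\<rho>1 \<theta>)\<^sup>2 + (\<rho> \<theta>)\<^sup>2 * \<rho>2 \<theta>) * r2 \<theta> - (\<rho> \<theta>)\<^sup>2 * \<rho>1 \<theta> * ?d) / (r2 \<theta>)\<^sup>2) (at \<theta>)"
      by (auto intro!: derivative_eq_intros rad_derivs(2) simp: power2_eq_square algebra_simps)
    have b: "((\<lambda>\<theta>. - p \<theta> + (\<rho> \<theta>)^3 / r2 \<theta>) has_real_derivative
        - D p \<theta> + (3 * (\<rho> \<theta>)\<^sup>2 * \<rho>1 \<theta> * r2 \<theta> - (\<rho> \<theta>)^3 * ?d) / (r2 \<theta>)\<^sup>2) (at \<theta>)"
      by (auto intro!: derivative_eq_intros rad_derivs(1) simp: power2_eq_square algebra_simps)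
    have c: "\<rho> \<theta> - p \<theta> - ((2 * \<rho> \<theta> * (\<rho>1 \<theta>)\<^sup>2 + (\<rho> \<theta>)\<^sup>2 * \<rho>2 \<theta>) * r2 \<theta> - (\<rho> \<theta>)\<^sup>2 * \<rho>1 \<theta> * ?d) / (r2 \<theta>)\<^sup>2
        - (- p \<theta> + (\<rho> \<theta>)^3 / r2 \<theta>) = q \<theta> * A \<theta>"
      unfolding A_def q_def using r2_nz[of \<theta>]
      by (simp add: divide_simps) (simp add: r2_def algebra_simps power2_eq_square power3_eq_cube)
    have d: "D p \<theta> - (\<rho> \<theta>)\<^sup>2 * \<rho>1 \<theta> / r2 \<theta> +
        (- D p \<theta> + (3 * (\<rho> \<theta>)\<^sup>2 * \<rho>1 \<theta> * r2 \<theta> - (\<rho> \<theta>)^3 * ?d) / (r2 \<theta>)\<^sup>2) = q \<theta> * B \<theta>"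
      unfolding B_def q_def using r2_nz[of \<theta>]
      by (simp add: divide_simps) (simp add: r2_def algebra_simps power2_eq_square power3_eq_cube)
    show ?thesis
      unfolding ses_frame[abs_def]
      using vector_derivative_at[OF frame_has_vector_derivative[OF a b]] unfolding c d .
  qed
  have "\<rho> differentiable (at \<theta>)" "\<rho>1 differentiable (at \<theta>)" "r2 differentiable (at \<theta>)"
    using rad_derivs(3,4) r2_deriv real_differentiable_def by blast+
  then have "A differentiable (at \<theta>)" "B differentiable (at \<theta>)"
    unfolding A_def B_def by (auto intro!: derivative_intros)
  then obtain A' B' where AB': "(A has_real_derivative A') (at \<theta>)" "(B has_real_derivative B') (at \<theta>)"
    by (auto simp: real_differentiable_def)
  have z: "((\<lambda>\<theta>. q \<theta> * X \<theta>) has_real_derivative 0) (at \<theta>)"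
    if "(X has_real_derivative X') (at \<theta>)" for X X'
    using DERIV_mult[OF q_deriv that] q' assms by simp
  have "(D (ses_curve p) has_vector_derivative 0) (at \<theta>)"
    unfolding 1 by (rule has_vector_derivative_eq_rhs[OF frame_has_vector_derivative[OF z[OF AB'(1)] z[OF AB'(2)]]])
      (simp add: assms)
  then have "D (D (ses_curve p)) \<theta> = 0"
    by (rule vector_derivative_at)
  moreover have "cusp_at (ses_curve p) \<theta>"
    using generic by (simp add: generic_hedgehog_def at_most_cusps_def 1 assms)
  ultimately show False
    using dependent_zero by (auto simp: cusp_at_def Let_def)
qed

text \<open>On \<Sigma> this is the absolute value of the \<alpha>-derivative of \<lambda>, namely
  |\<open>\<mu>\<alpha>\<close>| sqrt W, expressed through \<theta> alone.\<close>

definition S :: "real \<Rightarrow> real" where "S \<theta> = sqrt (r2 \<theta> + (\<rho> \<theta>)^4)"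
definition J :: "real \<Rightarrow> real" where
  "J \<theta> = (\<rho> \<theta>)\<^sup>2 / S \<theta> - (\<rho>1 \<theta>)\<^sup>2 / (S \<theta> * (1 + (\<rho> \<theta>)\<^sup>2))"
definition \<Phi> :: "real \<Rightarrow> real" where
  "\<Phi> \<theta> = 2 * q \<theta> * (\<rho> \<theta>)\<^sup>2 / (r2 \<theta> * S \<theta>) - S \<theta> / (1 + (\<rho> \<theta>)\<^sup>2)"
definition G :: "real \<Rightarrow> real" where "G \<theta> = - arctan (\<rho> \<theta> * \<rho>1 \<theta> / S \<theta>)"

text \<open>\<open>G\<close> is found by integrating the coefficient of \<open>\<rho>2\<close> in \<open>(J + \<Phi>) / 2\<close> with respect to \<open>\<rho>1\<close>.\<close>

lemma S_arg_pos: "r2 \<theta> + (\<rho> \<theta>)^4 > 0"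
  by (simp add: add_pos_nonneg)

lemma S_pos [simp]: "S \<theta> > 0"
  by (simp add: S_def S_arg_pos)

lemma S_nz [simp]: "S \<theta> \<noteq> 0"
  by (metis S_pos less_irrefl)

lemma S_square: "(S \<theta>)\<^sup>2 = r2 \<theta> + (\<rho> \<theta>)^4"
  using S_arg_pos[of \<theta>] by (simp add: S_def)

lemma one_plus_square_nz [simp]: "1 + x\<^sup>2 \<noteq> (0::real)"
  by (metis add.commute add_pos_nonneg less_irrefl zero_le_power2 zero_less_one)

lemma S_deriv:
  "(S has_real_derivative (\<rho> \<theta> * \<rho>1 \<theta> + \<rho>1 \<theta> * \<rho>2 \<theta> + 2 * (\<rho> \<theta>)^3 * \<rho>1 \<theta>) / S \<theta>) (at \<theta>)"
  unfolding S_def[abs_def] using S_arg_pos[of \<theta>]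
  by (auto intro!: derivative_eq_intros simp: divide_simps)

lemma G_deriv: "(G has_real_derivative (J \<theta> + \<Phi> \<theta>) / 2) (at \<theta>)"
proof -
  let ?s' = "(\<rho> \<theta> * \<rho>1 \<theta> + \<rho>1 \<theta> * \<rho>2 \<theta> + 2 * (\<rho> \<theta>)^3 * \<rho>1 \<theta>) / S \<theta>"
  define a b c s where abc: "a = \<rho> \<theta>" "b = \<rho>1 \<theta>" "c = \<rho>2 \<theta>" "s = S \<theta>"
  have s2: "s * s = a\<^sup>2 + b\<^sup>2 + a^4" and r2: "r2 \<theta> = a\<^sup>2 + b\<^sup>2" "a\<^sup>2 + b\<^sup>2 \<noteq> 0" and s: "s \<noteq> 0"
    using S_square[of \<theta>] r2_nz[of \<theta>] by (simp_all add: abc power2_eq_square r2_def)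
  have a: "1 + a\<^sup>2 \<noteq> 0" by simp
  have "s\<^sup>2 + (a * b)\<^sup>2 = (a\<^sup>2 + b\<^sup>2) * (1 + a\<^sup>2)"
    using s2 by algebra
  \<comment> \<open>The sum s^2 + (a b)^2 factors, which brings the denominator coming from arctan
    into the form found in \<open>J\<close> and \<open>\<Phi>\<close>.\<close>
  then have e: "1 + (a * b / s)\<^sup>2 = (a\<^sup>2 + b\<^sup>2) * (1 + a\<^sup>2) / s\<^sup>2"
    using s by (metis add_divide_distrib divide_self power_divide power_not_zero)
  have "(G has_real_derivative - (((\<rho>1 \<theta> * \<rho>1 \<theta> + \<rho> \<theta> * \<rho>2 \<theta>) * S \<theta> - \<rho> \<theta> * \<rho>1 \<theta> * ?s') / (S \<theta>)\<^sup>2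
       / (1 + (\<rho> \<theta> * \<rho>1 \<theta> / S \<theta>)\<^sup>2))) (at \<theta>)"
    unfolding G_def[abs_def]
    by (auto intro!: derivative_eq_intros S_deriv simp: power2_eq_square field_simps)
  also have "- (((\<rho>1 \<theta> * \<rho>1 \<theta> + \<rho> \<theta> * \<rho>2 \<theta>) * S \<theta> - \<rho> \<theta> * \<rho>1 \<theta> * ?s') / (S \<theta>)\<^sup>2
       / (1 + (\<rho> \<theta> * \<rho>1 \<theta> / S \<theta>)\<^sup>2)) =
     - (((b * b + a * c) * s\<^sup>2 - a * b * (a * b + b * c + 2 * a^3 * b)) / (s * (a\<^sup>2 + b\<^sup>2) * (1 + a\<^sup>2)))"
    unfolding abc[symmetric] e using s a r2(2) by (simp add: divide_simps power2_eq_square)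
  also have "\<dots> = (J \<theta> + \<Phi> \<theta>) / 2"
  proof -
    define r where "r = a\<^sup>2 + b\<^sup>2"
    have r: "r \<noteq> 0" using r2(2) by (simp add: r_def)
    have "J \<theta> + \<Phi> \<theta> = (a\<^sup>2 * r * (1 + a\<^sup>2) - b\<^sup>2 * r + 2 * (b\<^sup>2 - a * c) * a\<^sup>2 * (1 + a\<^sup>2) - s * s * r)
        / (s * r * (1 + a\<^sup>2))"
      unfolding J_def \<Phi>_def q_def r2(1) abc[symmetric] r_def[symmetric] using s a r
      by (simp add: divide_simps) (simp add: algebra_simps)
    also have "a\<^sup>2 * r * (1 + a\<^sup>2) - b\<^sup>2 * r + 2 * (b\<^sup>2 - a * c) * a\<^sup>2 * (1 + a\<^sup>2) - s * s * r =
       - 2 * ((b * b + a * c) * s\<^sup>2 - a * b * (a * b + b * c + 2 * a^3 * b))"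
      using s2 unfolding r_def by algebra
    finally have "J \<theta> + \<Phi> \<theta> = - 2 * ((b * b + a * c) * s\<^sup>2 - a * b * (a * b + b * c + 2 * a^3 * b))
        / (s * r * (1 + a\<^sup>2))" .
    moreover have "- (x / y) = - 2 * x / y / 2" for x y :: real by simp
    ultimately show ?thesis
      unfolding r_def by (simp only:)
  qed
  finally show ?thesis .
qed

section \<open>The total curvature\<close>

text \<open>The sign of \<open>R\<close> is that of \<open>\<rho>\<close>, unless \<open>\<rho>\<close> vanishes.\<close>

lemma polar:
  obtains R a where "a \<in> {0..pi}" "R \<noteq> 0" "\<rho> \<theta> = R * sin a" "\<rho>1 \<theta> = - R * cos a"
    "\<And>\<alpha>. \<mu> (\<alpha>, \<theta>) = R * sin (a - \<alpha>)"
proof -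
  \<comment> \<open>This sign makes \<rho> / R nonnegative, so that the polar angle lies in
    [0, \<pi>].\<close>
  define R where "R = (if \<rho> \<theta> \<ge> 0 then sqrt (r2 \<theta>) else - sqrt (r2 \<theta>))"
  have R: "R \<noteq> 0" "R\<^sup>2 = r2 \<theta>" "\<rho> \<theta> / R \<ge> 0"
    using r2_pos[of \<theta>] by (auto simp: R_def less_imp_le divide_le_0_iff)
  have "(- \<rho>1 \<theta> / R)\<^sup>2 + (\<rho> \<theta> / R)\<^sup>2 = 1"
    unfolding power_divide power2_minus add_divide_distrib[symmetric] R(2)
    using r2_nz[of \<theta>] by (simp add: r2_def add.commute)
  from sincos_total_pi[OF R(3) this]
  obtain a where a: "0 \<le> a" "a \<le> pi" "- \<rho>1 \<theta> / R = cos a" "\<rho> \<theta> / R = sin a"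
    by blast
  then have *: "\<rho> \<theta> = R * sin a" "\<rho>1 \<theta> = - R * cos a"
    using R(1) by (simp_all add: field_simps)
  then show ?thesis
    using that[of a R] a(1,2) R(1)
    by (simp add: \<mu>_def u_def sin_diff algebra_simps)
qed

text \<open>The curvature density; since \<open>sgn 0 = 0\<close> it vanishes on the singular set.\<close>

definition I :: "real \<times> real \<Rightarrow> real" where
  "I x = sgn (\<mu> x) * ((2 * u x - \<mu> x) / sqrt (W x) ^ 3)"

text \<open>The sign of \<mu> is constant on either side of its zero a, and the remaining factor has
  a primitive \<open>P\<close>. As P(0) + P(\<pi>) = 0, the two pieces add up to 2 sgn(R)
  P(a).\<close>

lemma I_inner: "((\<lambda>\<alpha>. I (\<alpha>, \<theta>)) has_integral 2 * J \<theta>) {0..pi}"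
proof -
  obtain R a where a: "a \<in> {0..pi}" and R: "R \<noteq> 0" "\<rho> \<theta> = R * sin a" "\<rho>1 \<theta> = - R * cos a"
    and mu: "\<And>\<alpha>. \<mu> (\<alpha>, \<theta>) = R * sin (a - \<alpha>)"
    using polar by blast
  \<comment> \<open>Since 2 u - \<mu> = \<rho> cos \<alpha> - \<rho>' sin \<alpha>, the two summands
    are primitives of these two terms, each divided by W^(3/2).\<close>
  define P where "P = (\<lambda>\<alpha>. \<rho> \<theta> * sin \<alpha> / sqrt (W (\<alpha>, \<theta>))
      + \<rho>1 \<theta> * cos \<alpha> / (sqrt (W (\<alpha>, \<theta>)) * (1 + (\<rho> \<theta>)\<^sup>2)))"
  have P': "(P has_real_derivative (2 * u (\<alpha>, \<theta>) - \<mu> (\<alpha>, \<theta>)) / sqrt (W (\<alpha>, \<theta>)) ^ 3) (at \<alpha>)" for \<alpha>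
  proof -
    define r b s c w where d: "r = \<rho> \<theta>" "b = \<rho>1 \<theta>" "s = sin \<alpha>" "c = cos \<alpha>" "w = sqrt (W (\<alpha>, \<theta>))"
    have w: "w > 0" "w * w = 1 + r\<^sup>2 * s\<^sup>2"
      by (simp_all add: d W_def m_def power_mult_distrib add_pos_nonneg)
    have sc: "s\<^sup>2 + c\<^sup>2 = 1" by (simp add: d)
    have w': "((\<lambda>\<alpha>. sqrt (W (\<alpha>, \<theta>))) has_real_derivative r\<^sup>2 * s * c / w) (at \<alpha>)"
    proof -
      have "((\<lambda>\<alpha>. W (\<alpha>, \<theta>)) has_real_derivative 2 * r\<^sup>2 * s * c) (at \<alpha>)"
        unfolding W_def m_def d by (auto intro!: derivative_eq_intros simp: power2_eq_square)
      from DERIV_chain2[where f = sqrt, OF DERIV_real_sqrt[OF W_pos] this]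
      show ?thesis
        unfolding d(5) by (rule DERIV_cong) (simp add: field_simps)
    qed
    let ?P' = "((r * c) * w - r * s * (r\<^sup>2 * s * c / w)) / (w * w)
        + ((b * (- s)) * (w * (1 + r\<^sup>2)) - b * c * (r\<^sup>2 * s * c / w * (1 + r\<^sup>2))) / ((w * (1 + r\<^sup>2)) * (w * (1 + r\<^sup>2)))"
    have "(P has_real_derivative ?P') (at \<alpha>)"
    proof -
      have "sqrt (W (\<alpha>, \<theta>)) \<noteq> 0" "sqrt (W (\<alpha>, \<theta>)) * (1 + r\<^sup>2) \<noteq> 0"
        using w(1) by (simp_all add: d)
      from DERIV_add[OF DERIV_divide[OF DERIV_cmult[OF DERIV_sin, of r] w' this(1)]
          DERIV_divide[OF DERIV_cmult[OF DERIV_cos, of b] DERIV_cmult_right[OF w', of "1 + r\<^sup>2"] this(2)]]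
      show ?thesis
        unfolding P_def d(1,2)[symmetric] unfolding d(3-5) by simp
    qed
    also have "?P' = (r * c - b * s) / w ^ 3"
    proof -
      have 1: "((r * c) * w - r * s * (r\<^sup>2 * s * c / w)) / (w * w) = r * c / w^3 * (w * w - r\<^sup>2 * s\<^sup>2)"
        using w(1) by (simp add: field_simps power2_eq_square power3_eq_cube)
      have 2: "((b * (- s)) * (w * k) - b * c * (r\<^sup>2 * s * c / w * k)) / ((w * k) * (w * k))
        = - (b * s / w^3) * (w * w + r\<^sup>2 * c\<^sup>2) / k" if "k \<noteq> 0" for k
        using w(1) that by (simp add: field_simps power2_eq_square power3_eq_cube)
      have 3: "w * w + r\<^sup>2 * c\<^sup>2 = 1 + r\<^sup>2" using w(2) sc by algebra
      have 4: "w * w - r\<^sup>2 * s\<^sup>2 = 1" using w(2) by simp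
      show ?thesis
        unfolding 1 2[OF one_plus_square_nz] 3 4 by (simp add: diff_divide_distrib)
    qed
    also have "r * c - b * s = 2 * u (\<alpha>, \<theta>) - \<mu> (\<alpha>, \<theta>)"
      by (simp add: d u_def \<mu>_def)
    finally show ?thesis by (simp only: d(5))
  qed
  \<comment> \<open>At the end points the sign of \<mu> may differ from \<open>e\<close>; two points
    do not affect the integral.\<close>
  have piece: "((\<lambda>\<alpha>. I (\<alpha>, \<theta>)) has_integral e * (P y - P x)) {x..y}"
    if "x \<le> y" "\<And>\<alpha>. x < \<alpha> \<Longrightarrow> \<alpha> < y \<Longrightarrow> sgn (\<mu> (\<alpha>, \<theta>)) = e" for x y e
  proof -
    have "((\<lambda>\<alpha>. e * ((2 * u (\<alpha>, \<theta>) - \<mu> (\<alpha>, \<theta>)) / sqrt (W (\<alpha>, \<theta>)) ^ 3)) has_integral e * (P y - P x)) {x..y}"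
      using P' that(1)
      by (intro has_integral_mult_right fundamental_theorem_of_calculus)
         (auto simp: has_real_derivative_iff_has_vector_derivative intro: has_vector_derivative_at_within)
    then show ?thesis
      by (rule has_integral_spike_finite[of "{x, y}", rotated 2]) (use that(2) in \<open>auto simp: I_def\<close>)
  qed
  have 1: "((\<lambda>\<alpha>. I (\<alpha>, \<theta>)) has_integral sgn R * (P a - P 0)) {0..a}"
  proof (rule piece)
    fix \<alpha> assume "0 < \<alpha>" "\<alpha> < a"
    then have "sin (a - \<alpha>) > 0" using a by (intro sin_gt_zero) auto
    then show "sgn (\<mu> (\<alpha>, \<theta>)) = sgn R" by (simp add: mu sgn_mult)
  qed (use a in auto)
  have 2: "((\<lambda>\<alpha>. I (\<alpha>, \<theta>)) has_integral - sgn R * (P pi - P a)) {a..pi}"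
  proof (rule piece)
    fix \<alpha> assume "a < \<alpha>" "\<alpha> < pi"
    then have "sin (\<alpha> - a) > 0" using a by (intro sin_gt_zero) auto
    moreover have "sin (a - \<alpha>) = - sin (\<alpha> - a)" by (simp add: sin_diff)
    ultimately have "sin (a - \<alpha>) < 0" by simp
    then show "sgn (\<mu> (\<alpha>, \<theta>)) = - sgn R" by (simp add: mu sgn_mult)
  qed (use a in auto)
  have "P 0 + P pi = 0"
    by (simp add: P_def W_def m_def)
  moreover have "sgn R * P a = J \<theta>"
  proof -
    have "(\<bar>R\<bar> * sqrt (W (a, \<theta>)))\<^sup>2 = R\<^sup>2 * (1 + (R * sin a * sin a)\<^sup>2)"
      by (simp add: power_mult_distrib less_imp_le) (simp add: W_def m_def R(2) power_mult_distrib)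
    also have "\<dots> = (R * sin a)\<^sup>2 + (- R * cos a)\<^sup>2 + (R * sin a)^4"
      using sin_cos_squared_add[of a] by algebra
    also have "\<dots> = (S \<theta>)\<^sup>2"
      unfolding S_square r2_def R(2,3) ..
    finally have "(\<bar>R\<bar> * sqrt (W (a, \<theta>)))\<^sup>2 = (S \<theta>)\<^sup>2" .
    then have Rw: "\<bar>R\<bar> * sqrt (W (a, \<theta>)) = S \<theta>"
      by (rule power2_eq_imp_eq) (simp_all add: less_imp_le)
    define w where "w = sqrt (W (a, \<theta>))"
    have w: "w \<noteq> 0" by (simp add: w_def)
    have "sgn R * P a = R / \<bar>R\<bar> * (R * sin a * sin a / w - R * cos a * cos a / (w * (1 + (\<rho> \<theta>)\<^sup>2)))"
      unfolding P_def w_def[symmetric] R(3) by (simp add: R(2) real_sgn_eq)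
    also have "\<dots> = (R * sin a)\<^sup>2 / (\<bar>R\<bar> * w) - (- R * cos a)\<^sup>2 / (\<bar>R\<bar> * w * (1 + (\<rho> \<theta>)\<^sup>2))"
      using R(1) w one_plus_square_nz[of "\<rho> \<theta>"]
      by (simp add: divide_simps power2_eq_square) (simp add: algebra_simps)
    also have "\<dots> = J \<theta>"
      unfolding J_def Rw[folded w_def] R(2,3) ..
    finally show ?thesis .
  qed
  ultimately have "sgn R * (P a - P 0) + - sgn R * (P pi - P a) = 2 * J \<theta>"
    by (simp add: algebra_simps) (metis add.commute add.left_neutral distrib_left mult_zero_right)
  then show ?thesis
    using has_integral_combine[OF _ _ 1 2] a by simp
qed

lemma continuous_coords: "continuous_on A u" "continuous_on A \<mu>" "continuous_on A W"
  using coord_derivs(1,3,6) by (meson continuous_at_imp_continuous_on has_derivative_continuous)+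

lemma I_measurable [measurable]: "I \<in> borel_measurable borel"
proof -
  have [measurable]: "u \<in> borel_measurable borel" "\<mu> \<in> borel_measurable borel" "W \<in> borel_measurable borel"
    using continuous_coords by (auto intro: borel_measurable_continuous_onI)
  show ?thesis unfolding I_def[abs_def] by measurable
qed

text \<open>The curvature has \<mu> in its denominator, but multiplied by |\<lambda>| it becomes a
  sign times a continuous function. The bound yields integrability.\<close>

lemma I_bounded:
  assumes "compact K"
  obtains B where "\<And>x. x \<in> K \<Longrightarrow> norm (I x) \<le> B"
proof -
  let ?f = "\<lambda>x. (2 * u x - \<mu> x) / sqrt (W x) ^ 3"
  have "compact (?f ` K)"
    using assms by (intro compact_continuous_image continuous_intros continuous_coords) auto
  then have "bounded (?f ` K)"
    by (rule compact_imp_bounded)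
  then obtain B where B: "\<forall>y\<in>?f ` K. norm y \<le> B"
    unfolding bounded_iff ..
  show ?thesis
  proof (rule that)
    fix x assume "x \<in> K"
    have "norm (I x) = norm (sgn (\<mu> x)) * norm (?f x)"
      unfolding I_def by (rule norm_mult)
    also have "\<dots> \<le> 1 * norm (?f x)"
      by (intro mult_right_mono) (simp_all add: sgn_real_def)
    also have "\<dots> \<le> B"
      using B \<open>x \<in> K\<close> by simp
    finally show "norm (I x) \<le> B" .
  qed
qed

lemma I_integrable: "set_integrable lborel ({0..pi} \<times> {0..<T}) I"
proof -
  obtain B where B: "\<And>x. x \<in> {0..pi} \<times> {0..T} \<Longrightarrow> norm (I x) \<le> B"
    by (rule I_bounded[OF compact_Times[OF compact_Icc compact_Icc]]) blast
  show ?thesis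
    unfolding set_integrable_def
  proof (rule integrableI_bounded_set_indicator)
    show "{0..pi} \<times> {0..<T} \<in> sets lborel"
      by (simp add: borel_Times)
    show "emeasure lborel ({0..pi} \<times> {0..<T}) < \<infinity>"
      by (intro emeasure_bounded_finite bounded_Times) auto
    have "norm (I x) \<le> B" if "x \<in> {0..pi} \<times> {0..<T}" for x
      using that by (intro B) auto
    then show "AE x in lborel. x \<in> {0..pi} \<times> {0..<T} \<longrightarrow> norm (I x) \<le> B"
      by blast
  qed simp
qed

lemma I_inner_integrable: "set_integrable lborel {0..pi} (\<lambda>\<alpha>. I (\<alpha>, \<theta>))"
proof -
  obtain B where B: "\<And>x. x \<in> {0..pi} \<times> {\<theta>} \<Longrightarrow> norm (I x) \<le> B"
    by (rule I_bounded[OF compact_Times[OF compact_Icc compact_sing]]) blast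
  show ?thesis
    unfolding set_integrable_def
  proof (rule integrableI_bounded_set_indicator)
    show "AE \<alpha> in lborel. \<alpha> \<in> {0..pi} \<longrightarrow> norm (I (\<alpha>, \<theta>)) \<le> B"
      using B by auto
  qed (auto intro!: emeasure_bounded_finite)
qed

text \<open>Fubini with \<alpha> as the inner variable, where \<open>I_inner\<close>
  applies.\<close>

lemma integral_I:
  assumes "T \<ge> 0"
  shows "(LINT x:({0..pi} \<times> {0..<T})|lborel. I x) = integral {0..T} (\<lambda>\<theta>. 2 * J \<theta>)"
proof -
  let ?f = "\<lambda>\<alpha> \<theta>. indicator ({0..pi} \<times> {0..<T}) (\<alpha>, \<theta>) *\<^sub>R I (\<alpha>, \<theta>)"
  have int: "integrable (lborel \<Otimes>\<^sub>M lborel) (case_prod ?f)"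
    using I_integrable[of T] by (simp add: lborel_prod case_prod_beta' set_integrable_def)
  have inner: "(\<integral>\<alpha>. ?f \<alpha> \<theta> \<partial>lborel) = indicator {0..<T} \<theta> *\<^sub>R (2 * J \<theta>)" for \<theta>
  proof -
    have "(\<integral>\<alpha>. ?f \<alpha> \<theta> \<partial>lborel) = indicator {0..<T} \<theta> * (LINT \<alpha>:{0..pi}|lborel. I (\<alpha>, \<theta>))"
      unfolding set_lebesgue_integral_def
      by (subst integral_mult_right_zero[symmetric], rule Bochner_Integration.integral_cong)
         (auto simp: indicator_def)
    also have "(LINT \<alpha>:{0..pi}|lborel. I (\<alpha>, \<theta>)) = 2 * J \<theta>"
      using set_borel_integral_eq_integral(2)[OF I_inner_integrable] I_inner integral_unique by metis
    finally show ?thesis by simp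
  qed
  have "set_integrable lborel {0..<T} (\<lambda>\<theta>. 2 * J \<theta>)"
    using lborel_pair.integrable_snd[OF int] unfolding inner set_integrable_def .
  moreover have "(LINT x:({0..pi} \<times> {0..<T})|lborel. I x) = (\<integral>x. case_prod ?f x \<partial>(lborel \<Otimes>\<^sub>M lborel))"
    by (simp add: set_lebesgue_integral_def lborel_prod case_prod_beta')
  moreover have "\<dots> = (LINT \<theta>:{0..<T}|lborel. 2 * J \<theta>)"
    unfolding lborel_pair.integral_snd[OF int, symmetric] inner set_lebesgue_integral_def ..
  ultimately have "(LINT x:({0..pi} \<times> {0..<T})|lborel. I x) = integral {0..<T} (\<lambda>\<theta>. 2 * J \<theta>)"
    using set_borel_integral_eq_integral(2) by metis
  also have "\<dots> = integral {0..T} (\<lambda>\<theta>. 2 * J \<theta>)"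
    by (rule integral_spike_set; rule negligible_subset[OF negligible_sing[of T]]) auto
  finally show ?thesis .
qed

lemma continuous_\<Phi>J: "continuous_on A \<Phi>" "continuous_on A J"
proof -
  have "continuous_on A \<rho>" "continuous_on A \<rho>1" "continuous_on A q" "continuous_on A r2" "continuous_on A S"
    using rad_derivs(3,4) q_deriv r2_deriv S_deriv
    by (meson continuous_at_imp_continuous_on DERIV_isCont)+
  then show "continuous_on A \<Phi>" "continuous_on A J"
    unfolding \<Phi>_def[abs_def] J_def[abs_def] by (auto intro!: continuous_intros)
qed

text \<open>\<open>G\<close> is a primitive of (J + \<Phi>) / 2 and depends on \<theta> only through
  \<rho> and \<rho>'; since these agree at both ends, the integral of J + \<Phi> is zero.\<close>

lemma integral_J:
  assumes "T \<ge> 0" "\<rho> T = \<rho> 0" "\<rho>1 T = \<rho>1 0"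
  shows "integral {0..T} (\<lambda>\<theta>. 2 * J \<theta>) = - 2 * integral {0..T} \<Phi>"
proof -
  have "((\<lambda>\<theta>. (J \<theta> + \<Phi> \<theta>) / 2) has_integral G T - G 0) {0..T}"
    using assms(1) G_deriv by (intro fundamental_theorem_of_calculus)
      (auto simp: has_real_derivative_iff_has_vector_derivative intro: has_vector_derivative_at_within)
  moreover have "G T = G 0"
    using assms by (simp add: G_def S_def r2_def)
  ultimately have "((\<lambda>\<theta>. (J \<theta> + \<Phi> \<theta>) / 2) has_integral 0) {0..T}"
    by simp
  have half: "x / 2 * 2 = x" for x :: real by simp
  from has_integral_mult_left[OF \<open>((\<lambda>\<theta>. (J \<theta> + \<Phi> \<theta>) / 2) has_integral 0) {0..T}\<close>, of 2]
  have "((\<lambda>\<theta>. J \<theta> + \<Phi> \<theta>) has_integral 0) {0..T}"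
    unfolding half by simp
  then have "integral {0..T} (\<lambda>\<theta>. J \<theta> + \<Phi> \<theta>) = 0"
    by (rule integral_unique)
  moreover have "integral {0..T} (\<lambda>\<theta>. J \<theta> + \<Phi> \<theta>) = integral {0..T} J + integral {0..T} \<Phi>"
    by (intro integral_add integrable_continuous_interval continuous_\<Phi>J)
  ultimately show ?thesis
    by (simp add: integral_mult_right)
qed

end

section \<open>Parameterizations of the singular set\<close>

lemma has_vector_derivative_chain:
  assumes "(f has_vector_derivative f') (at x)" "(g has_derivative g') (at (f x))"
  shows "((\<lambda>x. g (f x)) has_vector_derivative g' f') (at x)"
  using has_derivative_compose[OF assms(1)[unfolded has_vector_derivative_def] assms(2)]
    linear_simps(5)[OF has_derivative_bounded_linear[OF assms(2)]]
  by (simp add: has_vector_derivative_def)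

lemma periodic_derivative:
  fixes f f' :: "real \<Rightarrow> real"
  assumes "\<And>x. (f has_real_derivative f' x) (at x)" "\<And>x. f (x + T) = f x"
  shows "f' (x + T) = f' x"
  using assms(1)[of x] DERIV_shift[of f "f' (x + T)" x T] assms(1)[of "x + T"]
  by (auto simp: assms(2) intro: DERIV_unique)

text \<open>For an integer k the exponent n = 2 k is even; otherwise the curve is run through twice
  and the sign is squared.\<close>

lemma k_hedgehog_period:
  assumes "k_hedgehog k p"
  shows "2 * k_tilde k * pi > 0" "p (\<theta> + 2 * k_tilde k * pi) = p \<theta>"
proof -
  obtain n :: nat where n: "n > 0" "2 * k = real n" "\<And>\<theta>. p (\<theta> + 2 * k * pi) = (-1) ^ n * p \<theta>"
    using assms by (auto simp: k_hedgehog_def)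
  show "2 * k_tilde k * pi > 0"
    using n(1,2) by (auto simp: k_tilde_def)
  show "p (\<theta> + 2 * k_tilde k * pi) = p \<theta>"
  proof (cases "k \<in> \<int>")
    case True
    then obtain j where "k = of_int j" by (elim Ints_cases)
    then have "int n = 2 * j" using n(2) by linarith
    then have "even n" by presburger
    then show ?thesis using n(3) True by (simp add: k_tilde_def)
  next
    case False
    have "p (\<theta> + 2 * k * pi + 2 * k * pi) = (-1) ^ n * ((-1) ^ n * p \<theta>)"
      by (simp only: n(3))
    then show ?thesis
      using False by (simp add: k_tilde_def algebra_simps flip: power_add mult_2)
  qed
qed

context generic_front
begin

lemma smooth_upto_\<rho>: "smooth_upto n U \<rho>" "smooth_upto n U \<rho>1" "smooth_upto n U \<rho>2"
proof -
  have "smooth_upto n UNIV \<rho>" for n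
    using smooth_\<rho> smooth_on_iff_upto by blast
  then have "smooth_upto n U \<rho>" for n
    by (auto simp: smooth_upto_def)
  then show "smooth_upto n U \<rho>" "smooth_upto n U \<rho>1" "smooth_upto n U \<rho>2"
    unfolding \<rho>2_def \<rho>1_def using smooth_upto_SucE(2) by blast+
qed

text \<open>The equation \<mu> = 0 says that (\<rho>, \<rho>') is orthogonal to (cos \<alpha>, sin
  \<alpha>), so it is \<open>\<mu>\<alpha>\<close> times (-sin \<alpha>, cos \<alpha>). Its squared
  length \<open>r2\<close> is positive, whence the last claim.\<close>

lemma singular_identities:
  assumes "\<mu> x = 0"
  shows "\<mu>\<alpha> x * sin (fst x) = - \<rho> (snd x)" "\<mu>\<alpha> x * cos (fst x) = \<rho>1 (snd x)"
    "(\<mu>\<alpha> x)\<^sup>2 = r2 (snd x)" "\<mu>\<alpha> x * \<mu>\<theta> x = q (snd x)" "\<mu>\<alpha> x \<noteq> 0"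
proof -
  define r b c s C where d: "r = \<rho> (snd x)" "b = \<rho>1 (snd x)" "c = \<rho>2 (snd x)" "s = sin (fst x)" "C = cos (fst x)"
  have sc: "s\<^sup>2 + C\<^sup>2 = 1" by (simp add: d)
  have \<mu>: "r * C + b * s = 0"
    using assms by (simp add: \<mu>_def u_def d)
  have \<mu>\<alpha>: "\<mu>\<alpha> x = b * C - r * s" and \<mu>\<theta>: "\<mu>\<theta> x = b * C + c * s"
    by (simp_all add: \<mu>\<alpha>_def \<mu>\<theta>_def u\<theta>_def m_def d)
  show "\<mu>\<alpha> x * sin (fst x) = - \<rho> (snd x)" "\<mu>\<alpha> x * cos (fst x) = \<rho>1 (snd x)"
    "(\<mu>\<alpha> x)\<^sup>2 = r2 (snd x)" "\<mu>\<alpha> x * \<mu>\<theta> x = q (snd x)"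
    unfolding \<mu>\<alpha> \<mu>\<theta> r2_def q_def d[symmetric] using sc \<mu> by algebra+
  then show "\<mu>\<alpha> x \<noteq> 0"
    using r2_nz by (metis zero_power2)
qed

lemma \<mu>_slice_deriv: "((\<lambda>\<alpha>. \<mu> (\<alpha>, \<theta>)) has_real_derivative \<mu>\<alpha> (\<alpha>, \<theta>)) (at \<alpha>)"
  unfolding \<mu>_def \<mu>\<alpha>_def u_def u\<theta>_def m_def by (auto intro!: derivative_eq_intros)

text \<open>Eliminating \<rho>' from the two equations gives \<rho> sin (\<alpha> - \<beta>) = 0.
  Neither angle can be 0 or \<pi>, where \<mu> equals \<rho> up to sign, so the difference lies
  strictly between -\<pi> and \<pi>.\<close>

lemma singular_angle_unique:
  assumes "\<mu> (\<alpha>, \<theta>) = 0" "\<mu> (\<beta>, \<theta>) = 0" "\<alpha> \<in> {0..pi}" "\<beta> \<in> {0..pi}" "\<rho> \<theta> \<noteq> 0"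
  shows "\<alpha> = \<beta>"
proof -
  have open_angle: "\<alpha> \<noteq> 0 \<and> \<alpha> \<noteq> pi" if "\<mu> (\<alpha>, \<theta>) = 0" for \<alpha>
    using that assms(5) by (auto simp: \<mu>_def u_def)
  have "\<rho> \<theta> * sin (\<alpha> - \<beta>) = \<mu> (\<beta>, \<theta>) * sin \<alpha> - \<mu> (\<alpha>, \<theta>) * sin \<beta>"
    unfolding \<mu>_def u_def sin_diff fst_conv snd_conv by algebra
  then have "sin (\<alpha> - \<beta>) = 0"
    by (simp only: assms(1,2,5) mult_zero_left diff_self mult_eq_0_iff simp_thms)
  moreover have "- pi < \<alpha> - \<beta>" "\<alpha> - \<beta> < pi"
    using open_angle[OF assms(1)] open_angle[OF assms(2)] assms(3,4) by auto
  ultimately have "\<alpha> - \<beta> = 0"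
    using sin_eq_0_pi by blast
  then show ?thesis by simp
qed

text \<open>All these zeros are simple. The last set describes the singular points over a fixed
  \<theta>.\<close>

lemma finite_zeros:
  "finite {\<theta> \<in> {a..b}. \<rho> \<theta> = 0}" "finite {\<theta> \<in> {a..b}. q \<theta> = 0}"
  "finite {\<alpha> \<in> {a..b}. \<mu> (\<alpha>, \<theta>) = 0}"
proof -
  show "finite {\<theta> \<in> {a..b}. \<rho> \<theta> = 0}"
  proof (rule finite_simple_zeros[OF rad_derivs(3)])
    show "\<rho>1 x \<noteq> 0" if "\<rho> x = 0" for x
      using r2_nz[of x] that unfolding r2_def by auto
  qed
  show "finite {\<theta> \<in> {a..b}. q \<theta> = 0}"
    by (rule finite_simple_zeros[OF q_deriv q_simple_zeros])
  show "finite {\<alpha> \<in> {a..b}. \<mu> (\<alpha>, \<theta>) = 0}"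
    by (rule finite_simple_zeros[OF \<mu>_slice_deriv singular_identities(5)])
qed

text \<open>Away from the zeros of \<rho>, \<Sigma> is the graph of an explicit angle over \<theta>,
  and this graph serves as the parameterization.\<close>

lemma A2_parameterization_exists: "\<exists>U \<sigma>. A2_parameterization k p U \<sigma>"
proof -
  define T where "T = 2 * k_tilde k * pi"
  \<comment> \<open>Omitting \<theta> = 0 makes \<open>U\<close> open; at zeros of \<rho> the
    formula for \<open>a\<close> fails, and over zeros of \<open>q\<close> the singular points are
    not A2.\<close>
  define U where "U = {\<theta> \<in> {0<..<T}. \<rho> \<theta> \<noteq> 0 \<and> q \<theta> \<noteq> 0}"
  \<comment> \<open>For \<rho> nonzero, \<mu> = 0 reads cot \<alpha> = - \<rho>' / \<rho>; this is
    the solution in (0, \<pi>).\<close>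
  define a where "a = (\<lambda>\<theta>. pi / 2 + arctan (\<rho>1 \<theta> / \<rho> \<theta>))"
  define \<sigma> where "\<sigma> = (\<lambda>\<theta>. (a \<theta>, \<theta>))"
  have "continuous_on UNIV \<rho>" "continuous_on UNIV q"
    using rad_derivs(3) q_deriv by (meson continuous_at_imp_continuous_on DERIV_isCont)+
  then have "open ({0<..<T} \<inter> ({\<theta>. \<rho> \<theta> \<noteq> 0} \<inter> {\<theta>. q \<theta> \<noteq> 0}))"
    by (intro open_Int open_Collect_neq) auto
  moreover have "U = {0<..<T} \<inter> ({\<theta>. \<rho> \<theta> \<noteq> 0} \<inter> {\<theta>. q \<theta> \<noteq> 0})"
    by (auto simp: U_def)
  ultimately have U: "open U"
    by simp
  have a': "(a has_vector_derivative (- 1) * (q \<theta> * inverse (r2 \<theta>))) (at \<theta>)" if "\<theta> \<in> U" for \<theta>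
  proof -
    have "\<rho> \<theta> \<noteq> 0" using that by (simp add: U_def)
    from DERIV_add[OF DERIV_const[of "pi / 2"] DERIV_chain2[where f = arctan,
        OF DERIV_arctan DERIV_divide[OF rad_derivs(4) rad_derivs(3) this]]]
    have "(a has_real_derivative inverse (1 + (\<rho>1 \<theta> / \<rho> \<theta>)\<^sup>2) *
        ((\<rho>2 \<theta> * \<rho> \<theta> - \<rho>1 \<theta> * \<rho>1 \<theta>) / (\<rho> \<theta> * \<rho> \<theta>))) (at \<theta>)"
      by (simp add: a_def)
    moreover have "1 + (\<rho>1 \<theta> / \<rho> \<theta>)\<^sup>2 = r2 \<theta> / (\<rho> \<theta> * \<rho> \<theta>)"
      using \<open>\<rho> \<theta> \<noteq> 0\<close> by (simp add: r2_def field_simps power2_eq_square)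
    moreover have "inverse (r2 \<theta> / (\<rho> \<theta> * \<rho> \<theta>)) * ((\<rho>2 \<theta> * \<rho> \<theta> - \<rho>1 \<theta> * \<rho>1 \<theta>) / (\<rho> \<theta> * \<rho> \<theta>))
        = (- 1) * (q \<theta> * inverse (r2 \<theta>))"
      using \<open>\<rho> \<theta> \<noteq> 0\<close> by (simp add: q_def field_simps power2_eq_square)
    ultimately show ?thesis
      by (simp only: has_real_derivative_iff_has_vector_derivative)
  qed
  have smooth_r: "smooth_upto n U (\<lambda>\<theta>. (- 1) * (q \<theta> * inverse (r2 \<theta>)))" for n
  proof -
    have "smooth_upto n U (\<lambda>\<theta>. \<rho>1 \<theta> * \<rho>1 \<theta> + (- 1) * (\<rho> \<theta> * \<rho>2 \<theta>))"
      by (intro smooth_upto_add smooth_upto_mult smooth_upto_\<rho> U smooth_upto_const)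
    then have "smooth_upto n U q"
      by (simp add: q_def[abs_def] power2_eq_square)
    moreover have "smooth_upto n U (\<lambda>\<theta>. \<rho> \<theta> * \<rho> \<theta> + \<rho>1 \<theta> * \<rho>1 \<theta>)"
      by (intro smooth_upto_add smooth_upto_mult smooth_upto_\<rho> U)
    then have "smooth_upto n U r2"
      by (simp add: r2_def[abs_def] power2_eq_square)
    ultimately show ?thesis
      by (intro smooth_upto_mult smooth_upto_inverse U smooth_upto_const) auto
  qed
  have "smooth_upto n U a" for n
    using smooth_upto_SucI[OF U a' smooth_r] smooth_upto_SucD by blast
  then have smooth: "smooth_on U \<sigma>"
    unfolding smooth_on_iff_upto \<sigma>_def by (intro allI smooth_upto_Pair U smooth_upto_ident)
  have "(\<sigma> has_vector_derivative ((- 1) * (q \<theta> * inverse (r2 \<theta>)), 1)) (at \<theta>)" if "\<theta> \<in> U" for \<theta>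
    unfolding \<sigma>_def by (intro has_vector_derivative_Pair a' that has_vector_derivative_id)
  then have nz: "D \<sigma> \<theta> \<noteq> 0" if "\<theta> \<in> U" for \<theta>
    using that vector_derivative_at by (fastforce simp: zero_prod_def)
  have \<mu>0: "\<mu> (\<sigma> \<theta>) = 0" if "\<rho> \<theta> \<noteq> 0" for \<theta>
  proof -
    let ?y = "arctan (\<rho>1 \<theta> / \<rho> \<theta>)"
    have "sin ?y = \<rho>1 \<theta> / \<rho> \<theta> * cos ?y"
      using tan_arctan[of "\<rho>1 \<theta> / \<rho> \<theta>"] cos_arctan_not_zero[of "\<rho>1 \<theta> / \<rho> \<theta>"]
      by (simp add: tan_def nonzero_divide_eq_eq)
    then show ?thesis
      using that by (simp add: \<sigma>_def a_def \<mu>_def u_def sin_add cos_add)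
  qed
  have a_range: "a \<theta> \<in> {0..pi}" for \<theta>
    using arctan_lbound[of "\<rho>1 \<theta> / \<rho> \<theta>"] arctan_ubound[of "\<rho>1 \<theta> / \<rho> \<theta>"]
    by (simp add: a_def)
  have "\<sigma> ` U \<subseteq> A2_points k p"
  proof (rule image_subsetI)
    fix \<theta> assume \<theta>: "\<theta> \<in> U"
    then have z: "\<mu> (\<sigma> \<theta>) = 0" by (intro \<mu>0) (simp add: U_def)
    have "\<mu>\<theta> (\<sigma> \<theta>) \<noteq> 0"
      using singular_identities(4)[OF z] \<theta> by (auto simp: U_def \<sigma>_def)
    then show "\<sigma> \<theta> \<in> A2_points k p"
      using z \<theta> a_range[of \<theta>] by (simp add: A2_points_eq front_domain_def U_def \<sigma>_def T_def)
  qed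
  moreover have "finite (A2_points k p - \<sigma> ` U)"
  proof (rule finite_subset)
    \<comment> \<open>No A2-point lies over a zero of \<open>q\<close>, so the uncovered ones lie
      over \<theta> = 0 or over zeros of \<rho>.\<close>
    let ?Z = "insert 0 {\<theta> \<in> {0..T}. \<rho> \<theta> = 0}"
    show "finite (\<Union>\<theta>\<in>?Z. {\<alpha> \<in> {0..pi}. \<mu> (\<alpha>, \<theta>) = 0} \<times> {\<theta>})"
      using finite_zeros by (intro finite_UN_I finite_cartesian_product) auto
    show "A2_points k p - \<sigma> ` U \<subseteq> (\<Union>\<theta>\<in>?Z. {\<alpha> \<in> {0..pi}. \<mu> (\<alpha>, \<theta>) = 0} \<times> {\<theta>})"
    proof
      fix x assume x: "x \<in> A2_points k p - \<sigma> ` U"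
      obtain \<alpha> \<theta> where [simp]: "x = (\<alpha>, \<theta>)" by fastforce
      have A2: "\<alpha> \<in> {0..pi}" "\<theta> \<in> {0..<T}" "\<mu> (\<alpha>, \<theta>) = 0" "\<mu>\<theta> (\<alpha>, \<theta>) \<noteq> 0"
        using x by (auto simp: A2_points_eq front_domain_def T_def)
      have "\<theta> \<in> ?Z"
      proof (rule ccontr)
        assume "\<theta> \<notin> ?Z"
        then have \<theta>: "\<theta> \<in> {0<..<T}" "\<rho> \<theta> \<noteq> 0" using A2 by auto
        have "q \<theta> \<noteq> 0"
          using singular_identities(4,5)[OF A2(3)] A2(4) by auto
        with \<theta> have "\<theta> \<in> U" by (simp add: U_def)
        moreover have "\<alpha> = a \<theta>"
          using \<mu>0[OF \<theta>(2)] A2 a_range \<theta>(2) by (intro singular_angle_unique[of \<alpha> \<theta>]) (auto simp: \<sigma>_def)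
        ultimately show False using x by (auto simp: \<sigma>_def)
      qed
      then show "x \<in> (\<Union>\<theta>\<in>?Z. {\<alpha> \<in> {0..pi}. \<mu> (\<alpha>, \<theta>) = 0} \<times> {\<theta>})"
        by (rule UN_I) (use A2 in simp)
    qed
  qed
  moreover have "inj_on \<sigma> U"
    by (auto simp: inj_on_def \<sigma>_def)
  ultimately have "A2_parameterization k p U \<sigma>"
    unfolding A2_parameterization_def using U smooth nz by blast
  then show ?thesis by blast
qed

section \<open>The total singular curvature\<close>

text \<open>\<open>X\<close> and \<open>Y\<close> are the first two derivatives of the image of a singular curve with velocity
  \<open>(c, b)\<close>; the lemma is used with \<open>e = c\<close> and \<open>f = c'\<close>.\<close>

lemma singular_determinant:
  assumes "\<mu> x = 0"
    and X: "X = vector [e, e * (- u x * sin \<phi> - m x * cos \<phi>), e * (u x * cos \<phi> - m x * sin \<phi>)]"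
    and Y: "Y = vector [f, f * (- u x * sin \<phi> - m x * cos \<phi>) + e * (c * (2 * m x * sin \<phi> - 2 * u x * cos \<phi>) - b * \<mu>\<alpha> x * sin \<phi>),
       f * (u x * cos \<phi> - m x * sin \<phi>) + e * (- c * (2 * m x * cos \<phi> + 2 * u x * sin \<phi>) + b * \<mu>\<alpha> x * cos \<phi>)]"
    and \<phi>: "\<phi> = snd x + fst x"
  shows "det3 X Y (front_normal p x) =
    e\<^sup>2 / sqrt (W x) * (b * \<mu>\<alpha> x * W x - 2 * c * m x * (1 + (u x)\<^sup>2 + (m x)\<^sup>2))"
proof -
  define s C where sC: "s = sin \<phi>" "C = cos \<phi>"
  have sc: "s\<^sup>2 + C\<^sup>2 = 1" by (simp add: sC)
  have "det3 X Y (front_normal p x) = 1 / sqrt (W x) *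
     (e * e * (b * \<mu>\<alpha> x * (1 + (m x)\<^sup>2) - 2 * c * m x * (1 + (u x)\<^sup>2 + (m x)\<^sup>2)))"
    unfolding X Y front_normal_eq \<phi>[symmetric] det3_vector sC[symmetric]
    by (rule arg_cong[where f = "\<lambda>z. 1 / sqrt (W x) * z"]) (use sc in algebra)
  then show ?thesis
    by (simp add: W_def power2_eq_square)
qed

text \<open>Along a singular curve the image has velocity a multiple of \<open>F\<alpha>\<close>, so
  this gives its acceleration. The n-component of the \<theta>-derivative of
  \<open>F\<alpha>\<close> is \<mu> and drops out.\<close>

lemma F\<alpha>_along:
  assumes "(\<sigma> has_vector_derivative (c, b)) (at s)" "\<mu> (\<sigma> s) = 0" "(e has_real_derivative f) (at s)"
    and \<phi>: "\<phi> = snd (\<sigma> s) + fst (\<sigma> s)"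
  shows "((\<lambda>s. e s *\<^sub>R F\<alpha> (\<sigma> s)) has_vector_derivative
     vector [f, f * (- u (\<sigma> s) * sin \<phi> - m (\<sigma> s) * cos \<phi>)
         + e s * (c * (2 * m (\<sigma> s) * sin \<phi> - 2 * u (\<sigma> s) * cos \<phi>) - b * \<mu>\<alpha> (\<sigma> s) * sin \<phi>),
       f * (u (\<sigma> s) * cos \<phi> - m (\<sigma> s) * sin \<phi>)
         + e s * (- c * (2 * m (\<sigma> s) * cos \<phi> + 2 * u (\<sigma> s) * sin \<phi>) + b * \<mu>\<alpha> (\<sigma> s) * cos \<phi>)]) (at s)"
proof -
  let ?x = "\<sigma> s"
  have "(F\<alpha> has_derivative (\<lambda>v. vector [0,
      fst v * (2 * m ?x * sin \<phi> - 2 * u ?x * cos \<phi>) - snd v * \<mu>\<alpha> ?x * sin \<phi>,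
      - fst v * (2 * m ?x * cos \<phi> + 2 * u ?x * sin \<phi>) + snd v * \<mu>\<alpha> ?x * cos \<phi>])) (at ?x)"
    unfolding F\<alpha>_def[abs_def] Let_def \<phi>
    by (rule has_derivative_eq_rhs, rule has_derivative_vector_3)
       (auto intro!: derivative_eq_intros ext simp: assms(2) \<mu>\<alpha>_def algebra_simps)
  from has_vector_derivative_scaleR[OF assms(3) has_vector_derivative_chain[OF assms(1) this]]
  show ?thesis
    by (rule has_vector_derivative_eq_rhs)
       (simp add: F\<alpha>_def Let_def \<phi> vec_eq_iff forall_3)
qed

lemma norm_F\<alpha>: "(norm (e *\<^sub>R F\<alpha> x))\<^sup>2 = e\<^sup>2 * (1 + (\<rho> (snd x))\<^sup>2)"
proof -
  have "(u x)\<^sup>2 + (m x)\<^sup>2 = (\<rho> (snd x))\<^sup>2"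
    unfolding u_def m_def power_mult_distrib distrib_left[symmetric] by simp
  then show ?thesis
    by (simp add: power_mult_distrib power2_norm_eq_inner inner_F add.assoc)
qed

text \<open>Tangency gives c = - \<open>\<mu>\<theta>\<close> b / \<open>\<mu>\<alpha>\<close>, so
  the quotient is linear in b and the sign is - sgn b sgn \<open>\<mu>\<alpha>\<close>; together
  they leave |b|. The identities on \<Sigma> express the other factor through \<theta>.\<close>

lemma singular_curvature_integrand:
  assumes "\<mu> x = 0" "\<mu>\<alpha> x * c + \<mu>\<theta> x * b = 0" "c \<noteq> 0" "b \<noteq> 0"
  shows "sgn (\<mu>\<theta> x * c) * ((b * \<mu>\<alpha> x * W x - 2 * c * m x * (1 + (\<rho> (snd x))\<^sup>2)) / sqrt (W x) / (1 + (\<rho> (snd x))\<^sup>2))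
     = \<bar>b\<bar> * \<Phi> (snd x)"
proof -
  define \<theta> r where "\<theta> = snd x" and "r = \<rho> (snd x)"
  note id = singular_identities[OF assms(1)]
  define M w where "M = \<mu>\<alpha> x" and "w = sqrt (W x)"
  have M: "M \<noteq> 0" "M\<^sup>2 = r2 \<theta>" "M * \<mu>\<theta> x = q \<theta>"
    using id by (simp_all add: M_def \<theta>_def)
  have w: "w > 0" "w * w = W x" by (simp_all add: w_def less_imp_le)
  have "M * c = - (\<mu>\<theta> x * b)"
    using assms(2) unfolding M_def by linarith
  then have c: "c = - (\<mu>\<theta> x * b / M)"
    using M(1) by (metis minus_divide_left nonzero_mult_div_cancel_left)
  have "m x * M = r * (M * sin (fst x))"
    by (simp add: m_def r_def)
  also have "\<dots> = - r\<^sup>2"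
    unfolding M_def id(1) by (simp add: r_def power2_eq_square)
  finally have mM: "m x * M = - r\<^sup>2" .
  have "(\<bar>M\<bar> * w)\<^sup>2 = (S \<theta>)\<^sup>2"
  proof -
    have "(\<bar>M\<bar> * w)\<^sup>2 = M\<^sup>2 + (m x * M)\<^sup>2"
      unfolding power_mult_distrib power2_abs power2_eq_square[of w] w(2) W_def
      by (simp add: distrib_left mult.commute)
    then show ?thesis
      by (simp add: S_square mM M(2) r_def \<theta>_def flip: power_mult)
  qed
  then have S: "\<bar>M\<bar> * w = S \<theta>"
    by (rule power2_eq_imp_eq) (use w(1) in \<open>simp_all add: less_imp_le\<close>)
  have \<mu>\<theta>: "\<mu>\<theta> x \<noteq> 0" using c assms(3) by auto
  have "\<mu>\<theta> x * c = - ((\<mu>\<theta> x)\<^sup>2 * (b / M))"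
    unfolding c by (simp add: power2_eq_square)
  then have "sgn (\<mu>\<theta> x * c) = - (sgn ((\<mu>\<theta> x)\<^sup>2) * (sgn b / sgn M))"
    by (simp only: sgn_minus sgn_mult sgn_divide)
  moreover have "sgn ((\<mu>\<theta> x)\<^sup>2) = 1" "sgn b / sgn M = sgn b * sgn M"
    using \<mu>\<theta> by (simp_all add: sgn_real_def)
  ultimately have "sgn (\<mu>\<theta> x * c) = - (sgn b * sgn M)"
    by simp
  moreover have "(b * M * W x - 2 * c * m x * (1 + r\<^sup>2)) / w / (1 + r\<^sup>2) =
     b * (M * w / (1 + r\<^sup>2) + 2 * (\<mu>\<theta> x / M) * m x / w)"
    unfolding c w(2)[symmetric] using w(1) M(1) one_plus_square_nz[of r]
    by (simp add: divide_simps) (simp add: algebra_simps)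
  moreover have "- (sgn b * sgn M) * (b * (M * w / (1 + r\<^sup>2) + 2 * (\<mu>\<theta> x / M) * m x / w))
     = \<bar>b\<bar> * - (sgn M * (M * w / (1 + r\<^sup>2) + 2 * (\<mu>\<theta> x / M) * m x / w))"
    by (simp add: abs_sgn)
  moreover have "- (sgn M * (M * w / (1 + r\<^sup>2) + 2 * (\<mu>\<theta> x / M) * m x / w)) = \<Phi> \<theta>"
  proof -
    have "(\<mu>\<theta> x / M) * m x = (M * \<mu>\<theta> x) * (m x * M) / (M * M\<^sup>2)"
      using M(1) by (simp add: power2_eq_square)
    also have "\<dots> = - q \<theta> * r\<^sup>2 / (M * r2 \<theta>)"
      unfolding M(2,3) mM by simp
    finally have *: "(\<mu>\<theta> x / M) * m x = - q \<theta> * r\<^sup>2 / (M * r2 \<theta>)" .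
    have "2 * (\<mu>\<theta> x / M) * m x / w = 2 * ((\<mu>\<theta> x / M) * m x) / w"
      by simp
    then have 1: "2 * (\<mu>\<theta> x / M) * m x / w = - 2 * q \<theta> * r\<^sup>2 / (M * w * r2 \<theta>)"
      unfolding * by (simp add: mult_ac)
    have 2: "sgn M / M = 1 / \<bar>M\<bar>" "sgn M * M = \<bar>M\<bar>"
      using M(1) by (auto simp: sgn_real_def)
    have "- (sgn M * (M * w / (1 + r\<^sup>2) + 2 * (\<mu>\<theta> x / M) * m x / w))
       = (sgn M / M) * (2 * q \<theta> * r\<^sup>2 / (w * r2 \<theta>)) - (sgn M * M) * w / (1 + r\<^sup>2)"
      unfolding 1 by (simp add: algebra_simps)
    also have "\<dots> = 2 * q \<theta> * r\<^sup>2 / (r2 \<theta> * (\<bar>M\<bar> * w)) - \<bar>M\<bar> * w / (1 + r\<^sup>2)"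
      unfolding 2 by (simp add: mult_ac)
    also have "\<dots> = \<Phi> \<theta>"
      unfolding S \<Phi>_def r_def \<theta>_def ..
    finally show ?thesis .
  qed
  ultimately show ?thesis
    unfolding M_def[symmetric] w_def[symmetric] \<theta>_def[symmetric] r_def[folded \<theta>_def, symmetric]
    by (simp only:)
qed

end

section \<open>An arbitrary parameterization of the A2-points\<close>

locale front_parameterization = generic_front +
  fixes k :: real and U :: "real set" and \<sigma> :: "real \<Rightarrow> real \<times> real"
  assumes param: "A2_parameterization k p U \<sigma>"
begin

definition a where "a s = fst (\<sigma> s)"
definition b where "b s = snd (\<sigma> s)"
definition a' where "a' s = fst (D \<sigma> s)"
definition b' where "b' s = snd (D \<sigma> s)"

lemma U_open: "open U"
  using param by (simp add: A2_parameterization_def)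

lemma \<sigma>_A2:
  assumes "s \<in> U"
  shows "\<mu> (\<sigma> s) = 0" "\<mu>\<theta> (\<sigma> s) \<noteq> 0" "a s \<in> {0..pi}" "b s \<in> {0..<2 * k_tilde k * pi}"
proof -
  have "\<sigma> s \<in> A2_points k p"
    using param assms by (auto simp: A2_parameterization_def)
  then show "\<mu> (\<sigma> s) = 0" "\<mu>\<theta> (\<sigma> s) \<noteq> 0" "a s \<in> {0..pi}" "b s \<in> {0..<2 * k_tilde k * pi}"
    by (auto simp: A2_points_eq front_domain_def a_def b_def mem_Times_iff)
qed

lemma \<sigma>_deriv:
  assumes "s \<in> U"
  shows "(\<sigma> has_vector_derivative (a' s, b' s)) (at s)"
    "(a has_real_derivative a' s) (at s)" "(b has_real_derivative b' s) (at s)"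
    "a' differentiable (at s)" "b' differentiable (at s)"
proof -
  have "(D ^^ n) \<sigma> differentiable (at s)" for n
    using param assms by (simp add: A2_parameterization_def smooth_on_def)
  from this[of 0] this[of 1] have d: "\<sigma> differentiable (at s)" "D \<sigma> differentiable (at s)"
    by simp_all
  then show *: "(\<sigma> has_vector_derivative (a' s, b' s)) (at s)"
    by (simp add: vector_derivative_works a'_def b'_def)
  show "(a has_real_derivative a' s) (at s)" "(b has_real_derivative b' s) (at s)"
    using has_vector_derivative_chain[OF * has_derivative_fst[OF has_derivative_ident]]
      has_vector_derivative_chain[OF * has_derivative_snd[OF has_derivative_ident]]
    by (simp_all add: has_real_derivative_iff_has_vector_derivative a_def[abs_def] b_def[abs_def])
  show "a' differentiable (at s)" "b' differentiable (at s)"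
    unfolding a'_def[abs_def] b'_def[abs_def]
    using bounded_linear_imp_differentiable[OF bounded_linear_fst] bounded_linear_imp_differentiable[OF bounded_linear_snd]
      differentiable_compose[of fst "D \<sigma>" s UNIV] differentiable_compose[of snd "D \<sigma>" s UNIV] d(2)
    by auto
qed

text \<open>Differentiate \<mu> = 0 along the curve. Both coefficients are nonzero,
  \<open>\<mu>\<theta>\<close> by the A2 condition, so if one component of the velocity vanished,
  the other would too.\<close>

lemma tangent:
  assumes s: "s \<in> U"
  shows "\<mu>\<alpha> (\<sigma> s) * a' s + \<mu>\<theta> (\<sigma> s) * b' s = 0" "a' s \<noteq> 0" "b' s \<noteq> 0"
proof -
  have "((\<lambda>s. \<mu> (\<sigma> s)) has_vector_derivative \<mu>\<alpha> (\<sigma> s) * a' s + \<mu>\<theta> (\<sigma> s) * b' s) (at s)"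
    using has_vector_derivative_chain[OF \<sigma>_deriv(1)[OF s] coord_derivs(3)] by simp
  moreover have "((\<lambda>s. \<mu> (\<sigma> s)) has_vector_derivative 0) (at s)"
    by (rule has_vector_derivative_transform_within_open[OF has_vector_derivative_const[of 0] U_open s])
       (simp add: \<sigma>_A2)
  ultimately show *: "\<mu>\<alpha> (\<sigma> s) * a' s + \<mu>\<theta> (\<sigma> s) * b' s = 0"
    by (metis vector_derivative_at)
  have "D \<sigma> s \<noteq> 0"
    using param s by (simp add: A2_parameterization_def)
  then have "a' s \<noteq> 0 \<or> b' s \<noteq> 0"
    by (auto simp: a'_def b'_def prod_eq_iff)
  then show "a' s \<noteq> 0" "b' s \<noteq> 0"
    using * \<sigma>_A2(2)[OF s] singular_identities(5)[OF \<sigma>_A2(1)[OF s]] by auto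
qed

text \<open>Over a zero of \<open>\<rho>\<close> the singular angles are \<open>0\<close> and \<open>\<pi>\<close>; there \<open>a\<close> would have an extremum in
  the open set \<open>U\<close>, contradicting \<open>a' \<noteq> 0\<close>.\<close>

lemma \<rho>_nz:
  assumes s: "s \<in> U"
  shows "\<rho> (b s) \<noteq> 0"
proof
  assume \<rho>: "\<rho> (b s) = 0"
  obtain d where "d > 0" "ball s d \<subseteq> U"
    using U_open s by (rule openE)
  then have d: "d > 0" "\<And>t. \<bar>s - t\<bar> < d \<Longrightarrow> t \<in> U"
    by (auto simp: subset_iff dist_real_def)
  have "\<rho>1 (b s) \<noteq> 0"
    using r2_nz[of "b s"] \<rho> by (auto simp: r2_def)
  then have "sin (a s) = 0"
    using \<sigma>_A2(1)[OF s] \<rho> by (simp add: \<mu>_def u_def a_def b_def)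
  then have "a s = 0 \<or> a s = pi"
    using \<sigma>_A2(3)[OF s] sin_gt_zero[of "a s"] by force
  then have "a' s = 0"
  proof
    assume "a s = 0"
    then show ?thesis
      using d \<sigma>_A2(3) by (intro DERIV_local_min[OF \<sigma>_deriv(2)[OF s] d(1)]) auto
  next
    assume "a s = pi"
    then show ?thesis
      using d \<sigma>_A2(3) by (intro DERIV_local_max[OF \<sigma>_deriv(2)[OF s] d(1)]) auto
  qed
  with tangent(2)[OF s] show False by simp
qed

text \<open>Where \<rho> is nonzero the singular angle is determined by \<theta>, so injectivity
  passes from \<open>\<sigma>\<close> to its second coordinate. This admits \<theta> as the variable
  of integration.\<close>

lemma inj_b: "inj_on b U"
proof (rule inj_onI)
  fix s t assume st: "s \<in> U" "t \<in> U" "b s = b t"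
  have "a s = a t"
  proof (rule singular_angle_unique)
    show "\<mu> (a s, b s) = 0"
      using \<sigma>_A2(1)[OF st(1)] by (simp add: a_def b_def)
    show "\<mu> (a t, b s) = 0"
      unfolding st(3) using \<sigma>_A2(1)[OF st(2)] by (simp add: a_def b_def)
    show "\<rho> (b s) \<noteq> 0"
      by (rule \<rho>_nz[OF st(1)])
  qed (use st \<sigma>_A2(3) in auto)
  with st have "\<sigma> s = \<sigma> t" by (simp add: prod_eq_iff a_def b_def)
  then show "s = t"
    using st param by (auto simp: A2_parameterization_def inj_on_def)
qed

text \<open>Null vectors have the form (0, y), and the orientation forces y to have the sign of
  \<open>a' s\<close>; the result does not depend on the vector picked by
  \<open>SOME\<close>.\<close>

lemma oriented_null_vector_sgn:
  assumes s: "s \<in> U"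
  shows "sgn (frechet_derivative (area_density p) (at (\<sigma> s)) (oriented_null_vector p \<sigma> s)) = sgn (\<mu>\<theta> (\<sigma> s) * a' s)"
proof -
  let ?P = "\<lambda>v. frechet_derivative (front p) (at (\<sigma> s)) v = 0 \<and> fst (D \<sigma> s) * snd v - snd (D \<sigma> s) * fst v > 0"
  have "?P (0, a' s)"
    using tangent(2)[OF s] by (simp add: null_vector_iff \<sigma>_A2(1)[OF s] a'_def) (metis a'_def not_real_square_gt_zero)
  then have "?P (oriented_null_vector p \<sigma> s)"
    unfolding oriented_null_vector_def by (rule someI)
  then obtain y where "oriented_null_vector p \<sigma> s = (0, y)" "a' s * y > 0"
    by (cases "oriented_null_vector p \<sigma> s") (auto simp: null_vector_iff \<sigma>_A2(1)[OF s] a'_def)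
  then show ?thesis
    by (auto simp: frechet_area_density \<sigma>_A2(1)[OF s] sgn_mult zero_less_mult_iff)
qed

text \<open>The squared speed of the image is a'^2 (1 + \<rho>^2); its first factor cancels against
  the determinant, and \<open>singular_curvature_integrand\<close> evaluates the rest.\<close>

lemma singular_curvature_density:
  assumes s: "s \<in> U"
  shows "singular_curvature p \<sigma> s * norm (D (front p \<circ> \<sigma>) s) = \<bar>b' s\<bar> * \<Phi> (b s)"
proof -
  let ?x = "\<sigma> s" let ?\<phi> = "snd ?x + fst ?x"
  have 1: "((\<lambda>t. front p (\<sigma> t)) has_vector_derivative a' t *\<^sub>R F\<alpha> (\<sigma> t)) (at t)" if "t \<in> U" for t
  proof -
    have "F\<theta> (\<sigma> t) = 0"
      using \<sigma>_A2(1)[OF that] by (simp add: F\<theta>_def vec_eq_iff forall_3)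
    then show ?thesis
      using has_vector_derivative_chain[OF \<sigma>_deriv(1)[OF that] front_has_derivative] by simp
  qed
  then have D1: "D (front p \<circ> \<sigma>) t = a' t *\<^sub>R F\<alpha> (\<sigma> t)" if "t \<in> U" for t
    using that by (auto simp: o_def intro: vector_derivative_at)
  obtain f where f: "(a' has_real_derivative f) (at s)"
    using \<sigma>_deriv(4)[OF s] by (auto simp: real_differentiable_def)
  note d = F\<alpha>_along[OF \<sigma>_deriv(1)[OF s] \<sigma>_A2(1)[OF s] f refl]
  have D2: "D (D (front p \<circ> \<sigma>)) s = D (\<lambda>t. a' t *\<^sub>R F\<alpha> (\<sigma> t)) s"
    by (rule vector_derivative_at, rule has_vector_derivative_transform_within_open[OF _ U_open s])
       (use d D1 vector_derivative_at[OF d] in auto)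
  define n where "n = norm (a' s *\<^sub>R F\<alpha> ?x)"
  have n: "n\<^sup>2 = (a' s)\<^sup>2 * (1 + (\<rho> (b s))\<^sup>2)" "n \<noteq> 0"
    using norm_F\<alpha>[of "a' s" ?x] tangent(2)[OF s] F\<alpha>_nz by (simp_all add: n_def b_def)
  have um: "1 + (u ?x)\<^sup>2 + (m ?x)\<^sup>2 = 1 + (\<rho> (b s))\<^sup>2"
    using norm_F\<alpha>[of 1 ?x] by (simp add: power2_norm_eq_inner inner_F b_def)
  have det: "det3 (D (front p \<circ> \<sigma>) s) (D (D (front p \<circ> \<sigma>)) s) (front_normal p ?x) =
      (a' s)\<^sup>2 / sqrt (W ?x) * (b' s * \<mu>\<alpha> ?x * W ?x - 2 * a' s * m ?x * (1 + (\<rho> (b s))\<^sup>2))"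
    unfolding um[symmetric]
  proof (rule singular_determinant[OF \<sigma>_A2(1)[OF s] _ _ refl])
    show "D (front p \<circ> \<sigma>) s = vector [a' s, a' s * (- u ?x * sin ?\<phi> - m ?x * cos ?\<phi>),
        a' s * (u ?x * cos ?\<phi> - m ?x * sin ?\<phi>)]"
      by (simp add: D1[OF s] F\<alpha>_def Let_def vec_eq_iff forall_3)
  qed (fact D2[unfolded vector_derivative_at[OF d]])
  have "singular_curvature p \<sigma> s * norm (D (front p \<circ> \<sigma>) s) = sgn (\<mu>\<theta> ?x * a' s) *
     ((a' s)\<^sup>2 / sqrt (W ?x) * (b' s * \<mu>\<alpha> ?x * W ?x - 2 * a' s * m ?x * (1 + (\<rho> (b s))\<^sup>2)) / n ^ 3) * n"
    unfolding singular_curvature_def oriented_null_vector_sgn[OF s] det by (simp only: D1[OF s] n_def)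
  also have "\<dots> = sgn (\<mu>\<theta> ?x * a' s) *
     ((a' s)\<^sup>2 / sqrt (W ?x) * (b' s * \<mu>\<alpha> ?x * W ?x - 2 * a' s * m ?x * (1 + (\<rho> (b s))\<^sup>2)) / n\<^sup>2)"
    using n(2) by (simp add: power2_eq_square power3_eq_cube)
  also have "\<dots> = sgn (\<mu>\<theta> ?x * a' s) *
     ((b' s * \<mu>\<alpha> ?x * W ?x - 2 * a' s * m ?x * (1 + (\<rho> (b s))\<^sup>2)) / sqrt (W ?x) / (1 + (\<rho> (b s))\<^sup>2))"
    unfolding n(1) using tangent(2)[OF s] by simp
  also have "\<dots> = \<bar>b' s\<bar> * \<Phi> (b s)"
    using singular_curvature_integrand[OF \<sigma>_A2(1)[OF s] tangent[OF s]] by (simp add: b_def)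
  finally show ?thesis .
qed

text \<open>By \<open>polar\<close> every \<theta> carries a singular point. Unless \<theta> is the
  right end or a zero of \<open>q\<close>, this point is A2, so \<theta> can be missed only if the
  point is among the finitely many left out.\<close>

lemma b_image:
  "b ` U \<subseteq> {0..2 * k_tilde k * pi}" "finite ({0..2 * k_tilde k * pi} - b ` U)"
proof -
  let ?T = "2 * k_tilde k * pi"
  show "b ` U \<subseteq> {0..?T}"
    using \<sigma>_A2(4) by fastforce
  have "finite (A2_points k p - \<sigma> ` U)"
    using param by (simp add: A2_parameterization_def)
  then have "finite (insert ?T (snd ` (A2_points k p - \<sigma> ` U) \<union> {\<theta> \<in> {0..?T}. q \<theta> = 0}))"
    using finite_zeros(2) by simp
  moreover have "{0..?T} - b ` U \<subseteq> insert ?T (snd ` (A2_points k p - \<sigma> ` U) \<union> {\<theta> \<in> {0..?T}. q \<theta> = 0})"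
  proof
    fix \<theta> assume \<theta>: "\<theta> \<in> {0..?T} - b ` U"
    obtain R a where a: "a \<in> {0..pi}" "\<And>\<alpha>. \<mu> (\<alpha>, \<theta>) = R * sin (a - \<alpha>)"
      by (rule polar) blast
    have z: "\<mu> (a, \<theta>) = 0" by (simp add: a)
    have "(a, \<theta>) \<in> A2_points k p - \<sigma> ` U" if "\<theta> \<noteq> ?T" "q \<theta> \<noteq> 0"
    proof
      show "(a, \<theta>) \<in> A2_points k p"
        using \<theta> that a(1) z singular_identities(4)[OF z] by (auto simp: A2_points_eq front_domain_def)
      show "(a, \<theta>) \<notin> \<sigma> ` U"
      proof
        assume "(a, \<theta>) \<in> \<sigma> ` U"
        then obtain s where "s \<in> U" "(a, \<theta>) = \<sigma> s" by blast
        moreover from this(2) have "b s = \<theta>" by (metis b_def snd_conv)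
        ultimately show False using \<theta> by blast
      qed
    qed
    then show "\<theta> \<in> insert ?T (snd ` (A2_points k p - \<sigma> ` U) \<union> {\<theta> \<in> {0..?T}. q \<theta> = 0})"
      using \<theta> by force
  qed
  ultimately show "finite ({0..?T} - b ` U)"
    by (rule rev_finite_subset)
qed

text \<open>Change of variables \<theta> = b(s): |b'| is the Jacobian factor, and \<open>b\<close>
  maps \<open>U\<close> onto a full period up to finitely many points.\<close>

lemma singular_integral:
  "set_integrable lborel U (\<lambda>s. singular_curvature p \<sigma> s * norm (D (front p \<circ> \<sigma>) s))"
  "(LINT s:U|lborel. singular_curvature p \<sigma> s * norm (D (front p \<circ> \<sigma>) s)) =
     integral {0..2 * k_tilde k * pi} \<Phi>"
proof -
  let ?T = "2 * k_tilde k * pi" let ?f = "\<lambda>s. \<bar>b' s\<bar> * \<Phi> (b s)"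
  have neg: "negligible {x \<in> {0..?T} - b ` U. \<Phi> x \<noteq> 0}" "negligible {x \<in> b ` U - {0..?T}. \<Phi> x \<noteq> 0}"
  proof -
    show "negligible {x \<in> {0..?T} - b ` U. \<Phi> x \<noteq> 0}"
      by (rule negligible_finite[OF finite_subset[OF _ b_image(2)]]) blast
    show "negligible {x \<in> b ` U - {0..?T}. \<Phi> x \<noteq> 0}"
      by (rule empty_imp_negligible) (use b_image(1) in blast)
  qed
  have "\<Phi> absolutely_integrable_on {0..?T}"
    by (intro absolutely_integrable_continuous_real continuous_\<Phi>J)
  then have "\<Phi> absolutely_integrable_on (b ` U)"
    using neg by (rule absolutely_integrable_spike_set)
  moreover have "integral (b ` U) \<Phi> = integral {0..?T} \<Phi>"
    using neg by (intro integral_spike_set)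
  ultimately have ai: "?f absolutely_integrable_on U" "integral U ?f = integral {0..?T} \<Phi>"
    using has_absolute_integral_change_of_variables_1'[of U b b' \<Phi> "integral {0..?T} \<Phi>"] U_open inj_b
      \<sigma>_deriv(3) by (auto intro: has_field_derivative_at_within)
  have "continuous_on U b"
    by (rule continuous_at_imp_continuous_on) (use \<sigma>_deriv(3) DERIV_isCont in blast)
  moreover have "continuous_on U b'"
    by (rule continuous_at_imp_continuous_on) (use \<sigma>_deriv(5) differentiable_imp_continuous_within in blast)
  ultimately have "continuous_on U ?f"
    by (intro continuous_intros continuous_on_compose2[OF continuous_\<Phi>J(1)[of UNIV]]) auto
  \<comment> \<open>Absolute integrability refers to the completed measure; Borel measurability
    brings it back to \<open>lborel\<close>.\<close>
  then have "(\<lambda>s. indicator U s *\<^sub>R ?f s) \<in> borel_measurable borel"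
    using U_open by (intro borel_measurable_continuous_on_indicator) auto
  then have si: "set_integrable lborel U ?f"
    using ai(1) unfolding set_integrable_def by (subst (asm) integrable_completion) auto
  have cong: "indicator U s *\<^sub>R (singular_curvature p \<sigma> s * norm (D (front p \<circ> \<sigma>) s)) = indicator U s *\<^sub>R ?f s" for s
    using singular_curvature_density by (simp add: indicator_def)
  show "set_integrable lborel U (\<lambda>s. singular_curvature p \<sigma> s * norm (D (front p \<circ> \<sigma>) s))"
    using si unfolding set_integrable_def cong .
  have "(LINT s:U|lborel. singular_curvature p \<sigma> s * norm (D (front p \<circ> \<sigma>) s)) = (LINT s:U|lborel. ?f s)"
    unfolding set_lebesgue_integral_def cong ..
  also have "\<dots> = integral {0..?T} \<Phi>"
    using set_borel_integral_eq_integral(2)[OF si] ai(2) by simp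
  finally show "(LINT s:U|lborel. singular_curvature p \<sigma> s * norm (D (front p \<circ> \<sigma>) s)) = integral {0..?T} \<Phi>" .
qed

end

section \<open>Comparison of the two integrals\<close>

context generic_front
begin

text \<open>Off \<Sigma> the integrand is \<open>I\<close>, and on \<Sigma> \<open>I\<close>
  vanishes, so the domain can be filled up to the rectangle on which \<open>integral_I\<close>
  applies.\<close>

lemma curvature_integral:
  assumes "k_hedgehog k p"
  shows "set_integrable lborel (front_domain k - singular_set k p) (\<lambda>x. front_curvature p x * \<bar>area_density p x\<bar>)"
    "(LINT x:(front_domain k - singular_set k p)|lborel. front_curvature p x * \<bar>area_density p x\<bar>)
       = - 2 * integral {0..2 * k_tilde k * pi} \<Phi>"
proof -
  let ?T = "2 * k_tilde k * pi"
  have cong: "indicator (front_domain k - singular_set k p) x *\<^sub>R (front_curvature p x * \<bar>area_density p x\<bar>)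
      = indicator ({0..pi} \<times> {0..<?T}) x *\<^sub>R I x" for x
  proof (cases "\<mu> x = 0")
    case True
    then show ?thesis
      by (simp add: I_def singular_set_def area_density_zero_iff indicator_def)
  next
    case False
    have "sqrt (W x) ^ 3 * sqrt (W x) = (W x)\<^sup>2"
      by (simp add: power3_eq_cube power2_eq_square less_imp_le mult.assoc)
    then have W: "sqrt (W x) / (W x)\<^sup>2 = 1 / sqrt (W x) ^ 3"
      by (simp add: field_simps)
    have "front_curvature p x * \<bar>area_density p x\<bar> =
        (2 * u x - \<mu> x) * (\<bar>\<mu> x\<bar> / \<mu> x) * (sqrt (W x) / (W x)\<^sup>2)"
      unfolding front_curvature_eq[OF False] area_density_eq
      by (simp add: abs_mult less_imp_le)
    also have "\<dots> = I x"
    proof -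
      have "\<bar>\<mu> x\<bar> / \<mu> x = sgn (\<mu> x)" using False by (simp add: sgn_real_def)
      then show ?thesis unfolding W I_def by simp
    qed
    finally show ?thesis
      using False by (simp add: singular_set_def area_density_zero_iff indicator_def front_domain_def)
  qed
  show "set_integrable lborel (front_domain k - singular_set k p) (\<lambda>x. front_curvature p x * \<bar>area_density p x\<bar>)"
    using I_integrable[of ?T] unfolding set_integrable_def cong .
  note T = k_hedgehog_period[OF assms]
  \<comment> \<open>Periodicity passes from p to p', then to p'' = \<rho> - p, hence to \<rho> and
    \<rho>'.\<close>
  have "D p (x + ?T) = D p x" for x
    by (rule periodic_derivative[OF rad_derivs(1) T(2)])
  then have "\<rho> (x + ?T) = \<rho> x" for x
    using periodic_derivative[OF rad_derivs(2), of ?T x] T(2)[of x] by simp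
  moreover from this have "\<rho>1 (x + ?T) = \<rho>1 x" for x
    by (rule periodic_derivative[OF rad_derivs(3)])
  ultimately have "\<rho> ?T = \<rho> 0" "\<rho>1 ?T = \<rho>1 0"
    by (metis add_0)+
  then have "integral {0..?T} (\<lambda>\<theta>. 2 * J \<theta>) = - 2 * integral {0..?T} \<Phi>"
    using T(1) by (intro integral_J) auto
  moreover have "(LINT x:(front_domain k - singular_set k p)|lborel. front_curvature p x * \<bar>area_density p x\<bar>)
      = (LINT x:({0..pi} \<times> {0..<?T})|lborel. I x)"
    unfolding set_lebesgue_integral_def cong ..
  ultimately show "(LINT x:(front_domain k - singular_set k p)|lborel. front_curvature p x * \<bar>area_density p x\<bar>)
       = - 2 * integral {0..?T} \<Phi>"
    using integral_I[of ?T] T(1) by simp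
qed

end

theorem theorem4p6:
  fixes k :: real and p :: "real \<Rightarrow> real"
  assumes "k_hedgehog k p" and "generic_hedgehog p"
  shows "set_integrable lborel (front_domain k - singular_set k p)
           (\<lambda>x. front_curvature p x * \<bar>area_density p x\<bar>)
       \<and> (\<exists>U \<sigma>. A2_parameterization k p U \<sigma>)
       \<and> (\<forall>U \<sigma>. A2_parameterization k p U \<sigma> \<longrightarrow>
            set_integrable lborel U
              (\<lambda>s. singular_curvature p \<sigma> s * norm (D (front p \<circ> \<sigma>) s))
          \<and> (LINT x:(front_domain k - singular_set k p)|lborel.
               front_curvature p x * \<bar>area_density p x\<bar>)
            = - 2 * (LINT s:U|lborel.
                singular_curvature p \<sigma> s * norm (D (front p \<circ> \<sigma>) s)))"
proof -
  interpret generic_front p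
    using assms by unfold_locales (simp_all add: k_hedgehog_def)
  \<comment> \<open>The value is the same for every parameterization, so a single integral of
    \<open>\<Phi>\<close> over a period links both sides.\<close>
  have "set_integrable lborel U (\<lambda>s. singular_curvature p \<sigma> s * norm (D (front p \<circ> \<sigma>) s))
      \<and> (LINT s:U|lborel. singular_curvature p \<sigma> s * norm (D (front p \<circ> \<sigma>) s)) =
          integral {0..2 * k_tilde k * pi} \<Phi>"
    if "A2_parameterization k p U \<sigma>" for U \<sigma>
  proof -
    interpret front_parameterization p k U \<sigma>
      using that by unfold_locales
    show ?thesis using singular_integral by blast
  qed
  then show ?thesis
    using curvature_integral[OF assms(1)] A2_parameterization_exists by auto
qed

end
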